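(* Let $f=(x,\rho):\mathbb{Z}^2\to\mathbb{R}^3\times\mathbb{R}$ be a pre-hyperbolic net and let $\tilde x:\mathbb{Z}^2\to\mathbb{R}^3$ be a Weingarten transform of the discrete A-surface $x$. Then extending $\tilde x$ to a crisscrossed A-net $\tilde f=(\tilde x,\tilde\rho)$ by requiring that every pair of corresponding elementary quadrilaterals of $x$ and $\tilde x$, equipped with their crosses, be opposite faces of a Weingarten cube is consistent and yields a Weingarten transform $\tilde f$ of $f$ (in particular $\tilde f$ is a pre-hyperbolic net). The Weingarten transform $\tilde f$ is uniquely determined, modulo homogeneous rescaling $\tilde\rho\to c\tilde\rho$ with a constant $c\neq0$, by its supporting A-surface $\tilde x$.
   Context: Points lie in $\mathbb{R}^3$, the affine part of $\mathbb{R}\mathrm{P}^3$; $\operatorname{inc}[\cdot]$ denotes the subspace spanned by the given points. Discrete A-net: a map $x$ from $\mathbb{Z}^m$ (or from $\mathbb{Z}^2\times\{0,1\}$) to $\mathbb{R}^3$ such that every point $x(z)$ is coplanar with all its lattice neighbours (planar vertex stars); for $\mathbb{Z}^2$ it is called a discrete A-surface. Standing genericity assumption: elementary quadrilaterals are skew (non-coplanar) and every vertex star spans a unique plane (the vertex plane). Two A-surfaces $x,\tilde x:\mathbb{Z}^2\to\mathbb{R}^3$ are (discrete) Weingarten transforms of each other if for every $z$ the line $\operatorname{inc}[x(z),\tilde x(z)]$ is the intersection of the vertex planes of $x$ and $\tilde x$ at $x(z)$ and $\tilde x(z)$; equivalently, $X(\cdot,0)=x$, $X(\cdot,1)=\tilde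 x$ defines an A-net $X$ on $\mathbb{Z}^2\times\{0,1\}$ (also assumed generic). Cross: a cross adapted to a skew quadrilateral $(x_1,x_2,x_3,x_4)$ is a quadruple of coplanar points $p_{12},p_{23},p_{34},p_{41}$, with $p_{ij}$ on the line $\operatorname{inc}[x_i,x_j]$, different from $x_i,x_j$. The hyperboloid (doubly ruled quadric) determined by a cross is the unique one containing the four extended edges and the lines $\operatorname{inc}[p_{12},p_{34}]$, $\operatorname{inc}[p_{23},p_{41}]$. Crisscrossed A-net $(x,\rho)$: an A-net $x$ together with a nowhere vanishing real function $\rho$ on the vertices; on each extended edge with endpoints $x(z),x(z')$ it defines the cross vertex $\frac{\rho(z)x(z)+\rho(z')x(z')}{\rho(z)+\rho(z')}$ (a point at infinity if the denominator vanishes), and for each elementary quadrilateral the four cross vertices form a cross. $C^1$-condition: the hyperboloids determined by the crosses of two edge-adjacent quadrilaterals have the same tangent planes along the common edge line. Equivalently, the two cross vertices on the edges opposite to the common edge and the two endpoints of the common edge are coplanar. A pre-hyperbolic net is a crisscrossed A-surface $(x,\rho)$ for which the $C^1$-condition holds for any two edge-adjacent elementary quadrilaterals. Weingarten cube: an A-cube (combinatorial cube with faces $(x_1,\dots,x_4)$, $(\tilde x_1,\dots,\tilde x_4)$, $(x_i,x_{i+1},\tilde x_{i+1},\tilde x_i)$, all skew, with planar vertex stars) with crosses $(p_{ij})$, $(\tilde p_{ij})$ adapted to the opposite faces $(x_1,\dots,x_4)$, $(\tilde x_1,\dots,\tilde x_4)$ such that for all $i$ and $(j,k,l)=(i+1,i+2,i+3)$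 modulo 4, $\operatorname{inc}[p_{ij},\tilde p_{ij}]=\operatorname{inc}[x_i,x_j,p_{kl}]\cap\operatorname{inc}[\tilde x_i,\tilde x_j,\tilde p_{kl}]$. Weingarten transformation: two pre-hyperbolic nets $(x,\rho)$ and $(\tilde x,\tilde\rho)$ form a Weingarten pair (are Weingarten transforms of each other) if (i) $x,\tilde x$ are discrete Weingarten transforms of each other and (ii) any two corresponding quadrilaterals of $x$ and $\tilde x$, with their crosses, are opposite faces of a Weingarten cube.
   Formalization: The formal theorem also assumes that no elementary cube formed by corresponding quadrilaterals of x and x̃ has its vertices lying alternately on two lines; for such cubes the forced cross vertices need not be coplanar, and the claim as stated fails. *)

theory Defs
  imports "HOL-Analysis.Analysis"
begin

text \<open>
  Points of the real projective 3-space are given by homogeneous coordinates, that is, by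
  non-zero vectors of \<open>real^3 \<times> real\<close> up to scaling; vectors with last component \<open>0\<close> are the points
  at infinity. Projective subspaces are linear subspaces of \<open>real^3 \<times> real\<close>: points, lines and planes
  have linear dimension 1, 2 and 3.
\<close>

type_synonym point = "real^3"
type_synonym hpoint = "(real^3) \<times> real"

definition pt :: "point \<Rightarrow> hpoint" where
  "pt a = (a, 1)"

abbreviation inc :: "hpoint set \<Rightarrow> hpoint set" where
  "inc S \<equiv> span S"


text \<open>
  The four vertices of a quadrilateral are indexed by the type \<open>4\<close>, whose arithmetic is modulo 4
  (so that \<open>4 = 0\<close>). The elementary quadrilateral at \<open>z\<close> has its corners in cyclic order.
\<close>

definition corner :: "int \<times> int \<Rightarrow> 4 \<Rightarrow> int \<times> int" where
  "corner z i = z + (if i = 1 then (0, 0) else if i = 2 then (1, 0)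
                     else if i = 3 then (1, 1) else (0, 1))"

definition quad :: "(int \<times> int \<Rightarrow> point) \<Rightarrow> int \<times> int \<Rightarrow> 4 \<Rightarrow> point" where
  "quad x z i = x (corner z i)"

definition star :: "int \<times> int \<Rightarrow> (int \<times> int) set" where
  "star z = {z, z + (1, 0), z - (1, 0), z + (0, 1), z - (0, 1)}"

text \<open>Generic discrete A-surfaces: planar vertex stars spanning a plane, and skew quadrilaterals.\<close>

definition a_surface :: "(int \<times> int \<Rightarrow> point) \<Rightarrow> bool" where
  "a_surface x \<longleftrightarrow>
     (\<forall>z. coplanar (x ` star z)) \<and>
     (\<forall>z. aff_dim (x ` star z) = 2) \<and>
     (\<forall>z. \<not> coplanar (range (quad x z)))"

definition vertex_plane :: "(int \<times> int \<Rightarrow> point) \<Rightarrow> int \<times> int \<Rightarrow> hpoint set" where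
  "vertex_plane x z = inc (pt ` x ` star z)"

text \<open>
  The last conjunct is the genericity of the A-net formed by \<open>x\<close> and \<open>xt\<close> on
  \<open>\<int>\<^sup>2 \<times> {0, 1}\<close>, as far as it is not implied by the others: skewness of the quadrilaterals
  that join \<open>x\<close> and \<open>xt\<close>.
\<close>

definition discrete_weingarten ::
  "(int \<times> int \<Rightarrow> point) \<Rightarrow> (int \<times> int \<Rightarrow> point) \<Rightarrow> bool" where
  "discrete_weingarten x xt \<longleftrightarrow>
     a_surface x \<and> a_surface xt \<and>
     (\<forall>z. inc {pt (x z), pt (xt z)} = vertex_plane x z \<inter> vertex_plane xt z) \<and>
     (\<forall>z. \<forall>d \<in> {(1, 0), (0, 1)}. \<not> coplanar {x z, x (z + d), xt (z + d), xt z})"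


text \<open>
  For a cross \<open>p\<close>, the point \<open>p i\<close> is the one on the edge line through \<open>X i\<close> and \<open>X (i + 1)\<close>.
  Not lying in \<open>inc {pt (X i)}\<close> includes \<open>p i \<noteq> 0\<close>.
\<close>

definition adapted_cross :: "(4 \<Rightarrow> point) \<Rightarrow> (4 \<Rightarrow> hpoint) \<Rightarrow> bool" where
  "adapted_cross X p \<longleftrightarrow>
     (\<forall>i. p i \<in> inc {pt (X i), pt (X (i + 1))} \<and>
          p i \<notin> inc {pt (X i)} \<and> p i \<notin> inc {pt (X (i + 1))}) \<and>
     dim (inc (range p)) \<le> 3"

text \<open>
  Homogeneous coordinates of \<open>(\<rho>(z) x(z) + \<rho>(z') x(z')) / (\<rho>(z) + \<rho>(z'))\<close>; also
  correct when the denominator vanishes and the point lies at infinity.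
\<close>

definition cross_vertex ::
  "(int \<times> int \<Rightarrow> point) \<Rightarrow> (int \<times> int \<Rightarrow> real) \<Rightarrow> int \<times> int \<Rightarrow> int \<times> int \<Rightarrow> hpoint" where
  "cross_vertex x \<rho> z z' = \<rho> z *\<^sub>R pt (x z) + \<rho> z' *\<^sub>R pt (x z')"

definition net_cross ::
  "(int \<times> int \<Rightarrow> point) \<Rightarrow> (int \<times> int \<Rightarrow> real) \<Rightarrow> int \<times> int \<Rightarrow> 4 \<Rightarrow> hpoint" where
  "net_cross x \<rho> z i = cross_vertex x \<rho> (corner z i) (corner z (i + 1))"

definition crisscrossed ::
  "(int \<times> int \<Rightarrow> point) \<Rightarrow> (int \<times> int \<Rightarrow> real) \<Rightarrow> bool" where
  "crisscrossed x \<rho> \<longleftrightarrow>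
     a_surface x \<and> (\<forall>z. \<rho> z \<noteq> 0) \<and> (\<forall>z. adapted_cross (quad x z) (net_cross x \<rho> z))"


text \<open>
  A non-degenerate quadric is given by a non-degenerate symmetric bilinear form \<open>B\<close> (up to scaling),
  the quadric being the set of points \<open>q\<close> with \<open>B q q = 0\<close>. A non-degenerate quadric that
  contains a line is doubly ruled.
\<close>

definition nondegenerate_quadric :: "(hpoint \<Rightarrow> hpoint \<Rightarrow> real) \<Rightarrow> bool" where
  "nondegenerate_quadric B \<longleftrightarrow>
     bilinear B \<and> (\<forall>u v. B u v = B v u) \<and> (\<forall>u. (\<forall>v. B u v = 0) \<longrightarrow> u = 0)"

definition contains_subspace :: "(hpoint \<Rightarrow> hpoint \<Rightarrow> real) \<Rightarrow> hpoint set \<Rightarrow> bool" where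
  "contains_subspace B S \<longleftrightarrow> (\<forall>q \<in> S. B q q = 0)"

definition tangent_plane :: "(hpoint \<Rightarrow> hpoint \<Rightarrow> real) \<Rightarrow> hpoint \<Rightarrow> hpoint set" where
  "tangent_plane B q = {y. B q y = 0}"

definition cross_hyperboloid ::
  "(4 \<Rightarrow> point) \<Rightarrow> (4 \<Rightarrow> hpoint) \<Rightarrow> (hpoint \<Rightarrow> hpoint \<Rightarrow> real) \<Rightarrow> bool" where
  "cross_hyperboloid X p B \<longleftrightarrow>
     nondegenerate_quadric B \<and>
     (\<forall>i. contains_subspace B (inc {pt (X i), pt (X (i + 1))})) \<and>
     contains_subspace B (inc {p 1, p 3}) \<and>
     contains_subspace B (inc {p 2, p 4})"

text \<open>
  The quadrilaterals at \<open>z\<close> and \<open>z'\<close> are meant to be edge-adjacent, so that they share exactly the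
  two endpoints of the common edge.
\<close>

definition c1_condition ::
  "(int \<times> int \<Rightarrow> point) \<Rightarrow> (int \<times> int \<Rightarrow> real) \<Rightarrow> int \<times> int \<Rightarrow> int \<times> int \<Rightarrow> bool" where
  "c1_condition x \<rho> z z' \<longleftrightarrow>
     (\<exists>B B'. cross_hyperboloid (quad x z) (net_cross x \<rho> z) B \<and>
             cross_hyperboloid (quad x z') (net_cross x \<rho> z') B' \<and>
             (\<forall>q \<in> inc (pt ` x ` (range (corner z) \<inter> range (corner z'))) - {0}.
                tangent_plane B q = tangent_plane B' q))"

definition pre_hyperbolic ::
  "(int \<times> int \<Rightarrow> point) \<Rightarrow> (int \<times> int \<Rightarrow> real) \<Rightarrow> bool" where
  "pre_hyperbolic x \<rho> \<longleftrightarrow>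
     crisscrossed x \<rho> \<and>
     (\<forall>z. \<forall>d \<in> {(1, 0), (0, 1)}. c1_condition x \<rho> z (z + d))"


definition a_cube :: "(4 \<Rightarrow> point) \<Rightarrow> (4 \<Rightarrow> point) \<Rightarrow> bool" where
  "a_cube X Xt \<longleftrightarrow>
     \<not> coplanar (range X) \<and> \<not> coplanar (range Xt) \<and>
     (\<forall>i. \<not> coplanar {X i, X (i + 1), Xt (i + 1), Xt i}) \<and>
     (\<forall>i. coplanar {X i, X (i + 1), X (i - 1), Xt i}) \<and>
     (\<forall>i. coplanar {Xt i, Xt (i + 1), Xt (i - 1), X i})"

definition weingarten_cube ::
  "(4 \<Rightarrow> point) \<Rightarrow> (4 \<Rightarrow> hpoint) \<Rightarrow> (4 \<Rightarrow> point) \<Rightarrow> (4 \<Rightarrow> hpoint) \<Rightarrow> bool" where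
  "weingarten_cube X p Xt q \<longleftrightarrow>
     a_cube X Xt \<and> adapted_cross X p \<and> adapted_cross Xt q \<and>
     (\<forall>i. inc {p i, q i} =
          inc {pt (X i), pt (X (i + 1)), p (i + 2)} \<inter>
          inc {pt (Xt i), pt (Xt (i + 1)), q (i + 2)})"

definition corresponding_weingarten_cubes ::
  "(int \<times> int \<Rightarrow> point) \<Rightarrow> (int \<times> int \<Rightarrow> real) \<Rightarrow>
   (int \<times> int \<Rightarrow> point) \<Rightarrow> (int \<times> int \<Rightarrow> real) \<Rightarrow> bool" where
  "corresponding_weingarten_cubes x \<rho> xt \<rho>t \<longleftrightarrow>
     (\<forall>z. weingarten_cube (quad x z) (net_cross x \<rho> z) (quad xt z) (net_cross xt \<rho>t z))"

definition weingarten_pair ::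
  "(int \<times> int \<Rightarrow> point) \<Rightarrow> (int \<times> int \<Rightarrow> real) \<Rightarrow>
   (int \<times> int \<Rightarrow> point) \<Rightarrow> (int \<times> int \<Rightarrow> real) \<Rightarrow> bool" where
  "weingarten_pair x \<rho> xt \<rho>t \<longleftrightarrow>
     pre_hyperbolic x \<rho> \<and> pre_hyperbolic xt \<rho>t \<and>
     discrete_weingarten x xt \<and>
     corresponding_weingarten_cubes x \<rho> xt \<rho>t"


text \<open>
  A cube with planar vertex stars and skew faces can still be degenerate: its vertices may lie on two
  skew lines, alternating along the edges. The eighth vertex is then not determined by the other
  seven, and a cross on one face need not extend to a Weingarten cube. For example, take
  \<open>x(i,j)\<close> at parameter \<open>i + 2j\<close> and \<open>xt(i,j)\<close> at parameter \<open>1/2 + 5i + 7j\<close> on the two lines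
  \<open>t \<mapsto> (t,0,0)\<close> and \<open>t \<mapsto> (0,t,1)\<close>, with \<open>x\<close> on the first and \<open>xt\<close> on the second line if
  \<open>i + j\<close> is odd and conversely if it is even, and \<open>\<rho>(i,j) = 3\<close> to the power \<open>-ij\<close>. Generic
  means that no elementary cube is of this kind.
\<close>

definition two_line_cube :: "(4 \<Rightarrow> point) \<Rightarrow> (4 \<Rightarrow> point) \<Rightarrow> bool" where
  "two_line_cube X Xt \<longleftrightarrow>
     collinear {X 1, X 3, Xt 2, Xt 4} \<and> collinear {X 2, X 4, Xt 1, Xt 3}"

definition generic_cubes ::
  "(int \<times> int \<Rightarrow> point) \<Rightarrow> (int \<times> int \<Rightarrow> point) \<Rightarrow> bool" where
  "generic_cubes x xt \<longleftrightarrow> (\<forall>z. \<not> two_line_cube (quad x z) (quad xt z))"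

end

theory Submission
  imports Defs
begin

text \<open>
  A cross with vertex weights \<open>\<rho>\<close> is automatically planar. The tangent plane of its hyperboloid at
  the cross vertex \<open>p\<^sub>i\<close> is \<open>inc {x\<^sub>i, x\<^bsub>i+1\<^esub>, p\<^bsub>i+2\<^esub>}\<close>; since tangent planes at the vertices are
  the vertex planes, the C1-condition says precisely that this plane depends only on the edge and not
  on the quadrilateral. A Weingarten cube forces the new cross vertex to be the intersection of this
  plane with the edge of \<open>xt\<close>, which prescribes the ratio of the new weights along every edge. The
  ratios multiply to 1 around a quadrilateral because the matrix expressing one face of the cube
  in the other and its inverse have zeros at the entries of opposite corners, and the former has a
  non-zero diagonal entry unless the cube lies on two lines. They therefore integrate to
  a weight function that is unique up to a constant. Planarity of the cube also yields the second half of the cube condition: the old cross vertex lies in the new plane of its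
  edge. This new plane is hence spanned by the edge and the old cross vertex, so that it
  depends only on the edge, which is the C1-condition for the transform.
\<close>

subsection \<open>Frames and coordinates\<close>

lemma dim_le_3_if_subset_span:
  fixes u v w :: hpoint
  assumes "S \<subseteq> span {u, v, w}"
  shows "dim S \<le> 3"
proof -
  have "dim S \<le> card {u, v, w}"
    using assms by (intro dim_le_card) auto
  also have "\<dots> \<le> 3"
    by (simp add: card_insert_if)
  finally show ?thesis .
qed

text \<open>Normal form of indices modulo 4: each is written as \<open>i\<close>,
  \<open>i + 1\<close>, \<open>i + 2\<close> or \<open>i + 3\<close>, so that the predecessor of
  \<open>i\<close> appears as \<open>i + 3\<close> and the index 4 as 0.\<close>

lemma index_simps [simp]:
  fixes i :: 4
  shows "(4::4) = 0" "(5::4) = 1" "(6::4) = 2" "(7::4) = 3"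
    "i - 1 = i + 3" "i + 1 + 1 = i + 2" "i + 1 + 2 = i + 3" "i + 1 + 3 = i"
    "i + 2 + 1 = i + 3" "i + 2 + 2 = i" "i + 2 + 3 = i + 1"
    "i + 3 + 1 = i" "i + 3 + 2 = i + 1" "i + 3 + 3 = i + 2"
  by simp_all

lemma sum_4_rotate:
  fixes f :: "4 \<Rightarrow> 'a::comm_monoid_add"
  shows "sum f UNIV = f i + f (i + 1) + f (i + 2) + f (i + 3)"
  using exhaust_4[of i] by (elim disjE) (simp_all add: sum_4 ac_simps)

text \<open>Four vectors with a span of dimension 4 are distinct and form a basis; this is the
  homogeneous form of a skew quadrilateral.\<close>

definition frame :: "(4 \<Rightarrow> hpoint) \<Rightarrow> bool" where
  "frame a \<longleftrightarrow> dim (range a) = 4"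

lemma frame_inj: "inj a" and frame_independent: "independent (range a)"
  and frame_span: "span (range a) = UNIV" if "frame a"
proof -
  have "4 \<le> card (range a)"
    using that dim_le_card'[of "range a"] by (simp add: frame_def)
  moreover have "card (range a) \<le> 4"
    using card_image_le[of UNIV a] by simp
  ultimately have *: "card (range a) = 4"
    by simp
  then show "inj a"
    by (simp add: eq_card_imp_inj_on)
  show "independent (range a)"
    using * that by (intro card_le_dim_spanning[of _ "range a"]) (auto simp: frame_def span_base)
  show "span (range a) = UNIV"
    using that dim_eq_full[of "range a"] by (simp add: frame_def)
qed

definition coord :: "(4 \<Rightarrow> hpoint) \<Rightarrow> 4 \<Rightarrow> hpoint \<Rightarrow> real" where
  "coord a j y = representation (range a) y (a j)"

lemma linear_coord: "linear (coord a j)" if "frame a"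
  using bounded_linear_representation[OF frame_independent frame_span, OF that that]
  unfolding coord_def by (rule bounded_linear.linear)

lemma coord_frame:
  assumes "frame a"
  shows "coord a j (a k) = (if k = j then 1 else 0)"
  unfolding coord_def
  by (subst representation_basis) (use assms frame_independent frame_inj in \<open>auto simp: inj_eq\<close>)

lemmas coord_simps =
  linear_add[OF linear_coord] linear_diff[OF linear_coord] linear_scale[OF linear_coord]
  linear_0[OF linear_coord] coord_frame

lemma coord_expand:
  assumes "frame a"
  shows "y = coord a i y *\<^sub>R a i + coord a (i + 1) y *\<^sub>R a (i + 1)
             + coord a (i + 2) y *\<^sub>R a (i + 2) + coord a (i + 3) y *\<^sub>R a (i + 3)"
proof -
  have "y = (\<Sum>b\<in>range a. representation (range a) y b *\<^sub>R b)"
    using sum_representation_eq[of "range a" y "range a"] frame_independent[OF assms]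
      frame_span[OF assms] by simp
  also have "\<dots> = (\<Sum>j\<in>UNIV. coord a j y *\<^sub>R a j)"
    using frame_inj[OF assms] by (simp add: sum.reindex coord_def)
  finally show ?thesis
    by (simp add: sum_4_rotate[of _ i])
qed

lemma subspace_coord_kernel: "frame a \<Longrightarrow> subspace {y. coord a j y = 0}"
  by (auto simp: subspace_def coord_simps)

text \<open>The plane of a corner and its two neighbours is the coordinate plane that omits the
  opposite corner.\<close>

lemma vertex_span_iff:
  assumes "frame a"
  shows "y \<in> span {a (i + 3), a i, a (i + 1)} \<longleftrightarrow> coord a (i + 2) y = 0"
proof
  assume "y \<in> span {a (i + 3), a i, a (i + 1)}"
  moreover have "span {a (i + 3), a i, a (i + 1)} \<subseteq> {y. coord a (i + 2) y = 0}"
    using assms by (intro span_minimal subspace_coord_kernel) (auto simp: coord_frame)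
  ultimately show "coord a (i + 2) y = 0" by auto
next
  assume "coord a (i + 2) y = 0"
  with coord_expand[OF assms, of y i]
  have "y = coord a i y *\<^sub>R a i + coord a (i + 1) y *\<^sub>R a (i + 1) + coord a (i + 3) y *\<^sub>R a (i + 3)"
    by simp
  also have "\<dots> \<in> span {a (i + 3), a i, a (i + 1)}"
    by (intro span_add span_scale span_base) auto
  finally show "y \<in> span {a (i + 3), a i, a (i + 1)}" .
qed

definition cross_pt :: "(4 \<Rightarrow> hpoint) \<Rightarrow> (4 \<Rightarrow> real) \<Rightarrow> 4 \<Rightarrow> hpoint" where
  "cross_pt a r i = r i *\<^sub>R a i + r (i + 1) *\<^sub>R a (i + 1)"

text \<open>The tangent plane, at its cross vertex on the \<open>i\<close>-th edge, of the hyperboloid of the cross.\<close>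

definition edge_span :: "(4 \<Rightarrow> hpoint) \<Rightarrow> (4 \<Rightarrow> real) \<Rightarrow> 4 \<Rightarrow> hpoint set" where
  "edge_span a r i = span {a i, a (i + 1), cross_pt a r (i + 2)}"

text \<open>A plane through \<open>a i\<close> and \<open>a (i + 1)\<close> is cut out by an
  equation in the other two coordinates; at the opposite cross vertex these are
  \<open>r (i + 2)\<close> and \<open>r (i + 3)\<close>.\<close>

lemma edge_span_iff:
  assumes "frame a" "\<And>i. r i \<noteq> 0"
  shows "y \<in> edge_span a r i \<longleftrightarrow>
    coord a (i + 2) y * r (i + 3) = coord a (i + 3) y * r (i + 2)"
proof
  assume "y \<in> edge_span a r i"
  moreover have "edge_span a r i \<subseteq> {y. coord a (i + 2) y * r (i + 3) = coord a (i + 3) y * r (i + 2)}"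
    unfolding edge_span_def
    using assms by (intro span_minimal) (auto simp: coord_simps cross_pt_def subspace_def algebra_simps)
  ultimately show "coord a (i + 2) y * r (i + 3) = coord a (i + 3) y * r (i + 2)" by auto
next
  assume "coord a (i + 2) y * r (i + 3) = coord a (i + 3) y * r (i + 2)"
  then have "coord a (i + 3) y = coord a (i + 2) y / r (i + 2) * r (i + 3)"
    using assms(2)[of "i + 2"] by (simp add: field_simps)
  with coord_expand[OF assms(1), of y i]
  have "y = coord a i y *\<^sub>R a i + coord a (i + 1) y *\<^sub>R a (i + 1)
      + (coord a (i + 2) y / r (i + 2)) *\<^sub>R cross_pt a r (i + 2)"
    using assms(2)[of "i + 2"] by (simp add: cross_pt_def algebra_simps)
  also have "\<dots> \<in> edge_span a r i"
    unfolding edge_span_def by (intro span_add span_scale span_base) auto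
  finally show "y \<in> edge_span a r i" .
qed

text \<open>The vector \<open>y\<close> only certifies that \<open>u\<close>, \<open>v\<close>,
  \<open>w\<close> are independent. A proper subspace has dimension at most 3, so it is exhausted by
  them.\<close>

lemma span_triple_eqI:
  fixes S :: "hpoint set"
  assumes "subspace S" "{u, v, w} \<subseteq> S" "S \<noteq> UNIV" "dim {u, v, w, y} = 4"
  shows "S = span {u, v, w}"
proof -
  have "dim S \<noteq> 4"
    using dim_eq_full[of S] assms(3) span_eq_iff[THEN iffD2, OF assms(1)] by auto
  moreover have "dim S \<le> 4"
    using dim_subset_UNIV[of S] by simp
  moreover have "4 \<le> dim {u, v, w} + 1"
    using assms(4) dim_insert[of y "{u, v, w}"]
    by (simp add: insert_commute split: if_splits)
  ultimately have "dim (span {u, v, w}) \<ge> dim S"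
    by simp
  with assms(1,2) show ?thesis
    by (intro subspace_dim_equal[symmetric] span_minimal) auto
qed

subsection \<open>Homogeneous coordinates\<close>

lemma fst_pt: "fst (pt a) = a"
  by (simp add: pt_def)

text \<open>The last component of a linear combination of vectors \<open>pt t\<close> is the sum of
  its coefficients; that it equals 1 is the affine condition.\<close>

lemma pt_in_span_iff:
  assumes "finite T"
  shows "pt s \<in> span (pt ` T) \<longleftrightarrow> s \<in> affine hull T"
proof -
  have inj: "inj_on pt T"
    by (auto simp: inj_on_def pt_def)
  have *: "(\<Sum>t\<in>T. u t *\<^sub>R pt t) = (\<Sum>t\<in>T. u t *\<^sub>R t, sum u T)" for u
    by (simp add: pt_def prod_eq_iff fst_sum snd_sum)
  have "pt s \<in> span (pt ` T) \<longleftrightarrow> (\<exists>u. pt s = (\<Sum>v\<in>pt ` T. u v *\<^sub>R v))"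
    using assms by (auto simp: span_finite)
  also have "\<dots> \<longleftrightarrow> (\<exists>u. pt s = (\<Sum>t\<in>T. u t *\<^sub>R pt t))"
  proof
    assume "\<exists>u. pt s = (\<Sum>v\<in>pt ` T. u v *\<^sub>R v)"
    then obtain u where "pt s = (\<Sum>v\<in>pt ` T. u v *\<^sub>R v)" by blast
    then show "\<exists>u. pt s = (\<Sum>t\<in>T. u t *\<^sub>R pt t)"
      by (intro exI[of _ "u \<circ> pt"]) (simp add: sum.reindex[OF inj])
  next
    assume "\<exists>u. pt s = (\<Sum>t\<in>T. u t *\<^sub>R pt t)"
    then obtain u where "pt s = (\<Sum>t\<in>T. u t *\<^sub>R pt t)" by blast
    then show "\<exists>u. pt s = (\<Sum>v\<in>pt ` T. u v *\<^sub>R v)"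
      by (intro exI[of _ "u \<circ> fst"]) (simp add: sum.reindex[OF inj] fst_pt)
  qed
  also have "\<dots> \<longleftrightarrow> s \<in> affine hull T"
    unfolding * affine_hull_finite[OF assms] by (auto simp: pt_def)
  finally show ?thesis .
qed

lemma coplanar_iff_dim:
  assumes "finite S"
  shows "coplanar S \<longleftrightarrow> dim (pt ` S) \<le> 3"
proof
  assume "coplanar S"
  then obtain u v w where "S \<subseteq> affine hull {u, v, w}"
    by (auto simp: coplanar_def)
  then have "pt ` S \<subseteq> span (pt ` {u, v, w})"
    using pt_in_span_iff[of "{u, v, w}"] by auto
  then show "dim (pt ` S) \<le> 3"
    by (intro dim_le_3_if_subset_span[of _ "pt u" "pt v" "pt w"]) simp
next
  assume *: "dim (pt ` S) \<le> 3"
  \<comment> \<open>The basis is chosen among the given points, so that it comes from at most three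
    points of \<open>S\<close>, whose affine hull contains all of \<open>S\<close>.\<close>
  obtain B where B: "B \<subseteq> pt ` S" "independent B" "pt ` S \<subseteq> span B" "card B = dim (pt ` S)"
    using basis_exists[of "pt ` S"] by auto
  then obtain T where T: "T \<subseteq> S" "B = pt ` T"
    by (auto simp: subset_image_iff)
  have "finite T"
    using T(1) assms(1) finite_subset by blast
  have "card T = card B"
    using T by (simp add: card_image inj_on_def pt_def)
  also have "\<dots> \<le> 3"
    using B * by simp
  finally have "coplanar T"
    using \<open>finite T\<close> by (simp add: coplanar_small)
  moreover have "S \<subseteq> affine hull T"
    using B(3) T pt_in_span_iff[OF \<open>finite T\<close>] by auto
  ultimately show "coplanar S"
    using coplanar_affine_hull_coplanar coplanar_subset by blast
qed

lemma coplanar_if_subset_span: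
  assumes "finite S" "pt ` S \<subseteq> span {u, v, w}"
  shows "coplanar S"
  using coplanar_iff_dim[OF assms(1)] dim_le_3_if_subset_span[OF assms(2)] by blast

lemma not_coplanar_iff_dim:
  assumes "finite S"
  shows "\<not> coplanar S \<longleftrightarrow> dim (pt ` S) = 4"
  using coplanar_iff_dim[OF assms] dim_subset_UNIV[of "pt ` S"] by auto

lemma frame_iff_not_coplanar: "frame (\<lambda>i. pt (X i)) \<longleftrightarrow> \<not> coplanar (range X)"
  by (simp add: frame_def not_coplanar_iff_dim image_image)

subsection \<open>Cubes\<close>

text \<open>Applied a second time with the cyclic order reversed, which exchanges \<open>u\<close> with \<open>v\<close> and \<open>f\<close> with \<open>g\<close>.\<close>

lemma cube_relation_ahead:
  fixes d1 :: real
  assumes nz: "u1 \<noteq> 0" "u2 \<noteq> 0" "u3 \<noteq> 0" "u4 \<noteq> 0" "v1 \<noteq> 0" "v2 \<noteq> 0" "v3 \<noteq> 0" "v4 \<noteq> 0" "f1 \<noteq> 0" "d1 \<noteq> 0"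
    and d1: "d1 * f1 = - u1 * e2" "d1 * g1 = - v1 * e4"
    and e2: "e2 * u2 = - f2 * d3"
    and dd: "u2 * u3 * d1 = - v2 * v1 * d3"
    and fg: "f1 * u2 = - g1 * v4"
    and P: "u1 * u2 * u3 * u4 = v1 * v2 * v3 * v4"
  shows "f2 * v3 = g1 * u4"
proof -
  have "u3 * (f2 * d1) * u2 = v1 * v2 * e2 * u2"
    using e2 dd by algebra
  then have A: "u3 * f2 * d1 = v1 * v2 * e2"
    using nz by (simp add: mult.assoc)
  have B: "g1 * d1 = - v1 * e4"
    using d1 by algebra
  have "v1 * e4 * v4 = u1 * u2 * (- e2)"
    using d1 fg by algebra
  \<comment> \<open>After multiplication by \<open>u3 * u4\<close>, the identity \<open>P\<close>
    replaces the product of the \<open>u\<close>s by that of the \<open>v\<close>s, and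
    \<open>v1 * v4\<close> factors out.\<close>
  then have "v1 * v4 * (u3 * u4 * e4 + v2 * v3 * e2) = 0"
    using P by algebra
  then have C: "u3 * u4 * e4 + v2 * v3 * e2 = 0"
    using nz by simp
  have "u3 * d1 * (f2 * v3 - g1 * u4) = 0"
    using A B C by algebra
  then show ?thesis using nz by simp
qed

text \<open>
  The relations express that the substitutions \<open>b\<^sub>i = d\<^sub>i a\<^sub>i + u\<^sub>i a\<^bsub>i+1\<^esub> + v\<^sub>i a\<^bsub>i-1\<^esub>\<close> and
  \<open>a\<^sub>i = e\<^sub>i b\<^sub>i + f\<^sub>i b\<^bsub>i+1\<^esub> + g\<^sub>i b\<^bsub>i-1\<^esub>\<close> are inverse to each other.
\<close>

locale reduced_cube =
  fixes d u v e f g :: "4 \<Rightarrow> real"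
  assumes nonzero: "u i \<noteq> 0" "v i \<noteq> 0" "f i \<noteq> 0" "g i \<noteq> 0"
    and backward_next: "e i * u i + f i * d (i + 1) = 0"
    and backward_prev: "e i * v i + g i * d (i + 3) = 0"
    and backward_opposite: "f i * u (i + 1) + g i * v (i + 3) = 0"
    and forward_next: "d i * f i + u i * e (i + 1) = 0"
    and forward_prev: "d i * g i + v i * e (i + 3) = 0"
    and generic: "\<exists>i. d i \<noteq> 0"
begin

text \<open>Eliminating \<open>e i\<close> and \<open>f i\<close> from the three backward relations
  leaves a common factor \<open>g i\<close>, which is non-zero.\<close>

lemma diagonal: "u i * u (i + 1) * d (i + 3) = - v i * v (i + 3) * d (i + 1)"
proof -
  have "g i * (v i * v (i + 3) * d (i + 1) + u i * u (i + 1) * d (i + 3)) = 0"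
    using backward_next[of i] backward_prev[of i] backward_opposite[of i] by algebra
  then have "v i * v (i + 3) * d (i + 1) + u i * u (i + 1) * d (i + 3) = 0"
    using nonzero by simp
  then show ?thesis by algebra
qed

lemma diagonal_opposite_nonzero: "d (i + 2) \<noteq> 0" if "d i \<noteq> 0"
  using diagonal[of "i + 3"] nonzero[of i] nonzero[of "i + 3"] nonzero[of "i + 2"] that
  by auto

text \<open>Two opposite instances of \<open>diagonal\<close> relate \<open>d j\<close> and
  \<open>d (j + 2)\<close> in both directions. Their product can be divided by
  \<open>d j * d (j + 2)\<close>, which is non-zero by genericity.\<close>

lemma prod_eq: "u i * u (i + 1) * u (i + 2) * u (i + 3) = v i * v (i + 1) * v (i + 2) * v (i + 3)"
proof -
  obtain j where j: "d j \<noteq> 0" using generic by blast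
  have "u j * u (j + 1) * u (j + 2) * u (j + 3) = v j * v (j + 1) * v (j + 2) * v (j + 3)"
    using diagonal[of "j + 1"] diagonal[of "j + 3"] j diagonal_opposite_nonzero[OF j]
    by simp algebra
  moreover have "j = i \<or> j = i + 1 \<or> j = i + 2 \<or> j = i + 3"
    using exhaust_4[of i] exhaust_4[of j] by (elim disjE) simp_all
  ultimately show ?thesis
    by (elim disjE) (simp_all add: ac_simps)
qed

lemma cyclic_solution:
  assumes "\<And>i. r i \<noteq> 0"
  obtains s where "\<And>i. s i \<noteq> 0" 
    "\<And>i. s (i + 1) * u (i + 1) * r (i + 3) = s i * v i * r (i + 2)"
proof -
  \<comment> \<open>Starting from the weight 1 at corner 1, the required equations for the edges 1,
    2 and 3 successively force the values at 2, 3 and 0.\<close>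
  define s2 where "s2 = v 1 * r 3 / (u 2 * r 0)"
  define s3 where "s3 = s2 * v 2 * r 0 / (u 3 * r 1)"
  define s0 where "s0 = s3 * v 3 * r 1 / (u 0 * r 2)"
  define s :: "4 \<Rightarrow> real" where
    "s i = (if i = 1 then 1 else if i = 2 then s2 else if i = 3 then s3 else s0)" for i
  have s_simps: "s 1 = 1" "s 2 = s2" "s 3 = s3" "s 0 = s0"
    by (simp_all add: s_def)
  have nz: "s i \<noteq> 0" for i
    using nonzero assms by (simp add: s_def s0_def s3_def s2_def)
  have "u 1 * u 2 * u 3 * u 0 = v 1 * v 2 * v 3 * v 0"
    using prod_eq[of 1] by simp
  \<comment> \<open>The equation for the edge 0 closes the cycle; there the weights \<open>r\<close>
    cancel and the product identity remains.\<close>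
  then have "u 1 * r 3 = s0 * v 0 * r 2"
    using nonzero assms by (simp add: s0_def s3_def s2_def field_simps)
  then have "s (i + 1) * u (i + 1) * r (i + 3) = s i * v i * r (i + 2)" for i
    using exhaust_4[of i] nonzero assms
    by (elim disjE) (simp_all add: s_simps s2_def s3_def s0_def)
  with nz that show ?thesis by blast
qed

text \<open>This turns the incidence equation for the new cross vertex on edge \<open>i + 2\<close>
  into the one for the old cross vertex on edge \<open>i\<close>. Opposite diagonal entries vanish
  together, so one of \<open>d i\<close>, \<open>d (i + 1)\<close> is non-zero; the two cases are
  mirror images.\<close>

lemma cube_relation: "f (i + 1) * v (i + 2) = g i * u (i + 3)"
proof -
  have "d i \<noteq> 0 \<or> d (i + 1) \<noteq> 0"
  proof -
    obtain j where "d j \<noteq> 0" using generic by blast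
    moreover have "j = i \<or> j = i + 1 \<or> j = i + 2 \<or> j = i + 3"
      using exhaust_4[of i] exhaust_4[of j] by (elim disjE) simp_all
    ultimately show ?thesis
      using diagonal_opposite_nonzero[of j] by auto
  qed
  then show ?thesis
  proof
    assume d: "d i \<noteq> 0"
    have "u (i + 1) * u (i + 2) * d i = - v (i + 1) * v i * d (i + 2)"
      using diagonal[of "i + 1"] by simp
    moreover have "e (i + 1) * u (i + 1) = - f (i + 1) * d (i + 2)"
      using backward_next[of "i + 1"] by simp
    moreover have "d i * f i = - u i * e (i + 1)" "d i * g i = - v i * e (i + 3)"
      "f i * u (i + 1) = - g i * v (i + 3)"
      using forward_next[of i] forward_prev[of i] backward_opposite[of i] by simp_all
    ultimately show ?thesis
      using d prod_eq[of i]
      by (intro cube_relation_ahead[where ?d1.0 = "d i" and ?f1.0 = "f i" and ?e4.0 = "e (i + 3)",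
            OF nonzero(1,1,1,1,2,2,2,2,3)]) assumption+
  next
    assume d: "d (i + 1) \<noteq> 0"
    have "v i * v (i + 3) * d (i + 1) = - u i * u (i + 1) * d (i + 3)"
      using diagonal[of i] by algebra
    moreover have "e i * v i = - g i * d (i + 3)"
      using backward_prev[of i] by algebra
    moreover have "d (i + 1) * f (i + 1) = - u (i + 1) * e (i + 2)"
      "d (i + 1) * g (i + 1) = - v (i + 1) * e i"
      "g (i + 1) * v i = - f (i + 1) * u (i + 2)"
      using forward_next[of "i + 1"] forward_prev[of "i + 1"] backward_opposite[of "i + 1"] by simp_all
    moreover have "v (i + 1) * v i * v (i + 3) * v (i + 2) = u (i + 1) * u i * u (i + 3) * u (i + 2)"
      using prod_eq[of i] by algebra
    ultimately have "g i * u (i + 3) = f (i + 1) * v (i + 2)"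
      using d
      by (intro cube_relation_ahead[where ?d1.0 = "d (i + 1)" and ?f1.0 = "g (i + 1)" and ?e4.0 = "e (i + 2)",
            OF nonzero(2,2,2,2,1,1,1,1,4)]) assumption+
    then show ?thesis by simp
  qed
qed

end

section \<open>Cubes in homogeneous coordinates\<close>

lemma dim_4I:
  fixes S :: "hpoint set"
  assumes "dim T = 4" "T \<subseteq> span S"
  shows "dim S = 4"
  using dim_mono[OF assms(2)] dim_subset_UNIV[of S] assms(1) by simp

lemma dim_frame: "dim {a (i + 3), a i, a (i + 1), a (i + 2)} = 4" if "frame a"
proof (rule dim_4I)
  show "range a \<subseteq> span {a (i + 3), a i, a (i + 1), a (i + 2)}"
  proof (rule image_subsetI)
    fix y
    show "a y \<in> span {a (i + 3), a i, a (i + 1), a (i + 2)}"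
      by (subst coord_expand[OF that, of "a y" i]) (intro span_add span_scale span_base; simp)
  qed
qed (use that in \<open>simp add: frame_def\<close>)

lemma in_span_pairI:
  assumes "p = x *\<^sub>R u + y *\<^sub>R v" "x \<noteq> 0" "p \<in> span S" "v \<in> span S"
  shows "u \<in> span S"
proof -
  have "u = (1 / x) *\<^sub>R (p - y *\<^sub>R v)"
    using assms by simp
  also have "\<dots> \<in> span S"
    using assms by (intro span_scale span_diff)
  finally show ?thesis .
qed

text \<open>The homogeneous form of an A-cube. The assumptions are symmetric in the two faces, so
  each result can be reused with \<open>a\<close> and \<open>b\<close> exchanged.\<close>

locale skew_cube =
  fixes a b :: "4 \<Rightarrow> hpoint"
  assumes frames: "frame a" "frame b"
    and star_a: "b i \<in> span {a (i + 3), a i, a (i + 1)}"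
    and star_b: "a i \<in> span {b (i + 3), b i, b (i + 1)}"
    and skew: "dim {a i, a (i + 1), b i, b (i + 1)} = 4"
begin

lemma swap: "skew_cube b a"
  by unfold_locales (use frames star_a star_b skew in \<open>auto simp: insert_commute\<close>)

abbreviation "d i \<equiv> coord a i (b i)"
abbreviation "u i \<equiv> coord a (i + 1) (b i)"
abbreviation "v i \<equiv> coord a (i + 3) (b i)"
abbreviation "e i \<equiv> coord b i (a i)"
abbreviation "f i \<equiv> coord b (i + 1) (a i)"
abbreviation "g i \<equiv> coord b (i + 3) (a i)"

lemma coord_opposite: "coord a (i + 2) (b i) = 0"
  using star_a[of i] vertex_span_iff[OF frames(1)] by blast

lemma b_expand: "b i = d i *\<^sub>R a i + u i *\<^sub>R a (i + 1) + v i *\<^sub>R a (i + 3)"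
  using coord_expand[OF frames(1), of "b i" i] coord_opposite[of i] by simp

lemma a_expand: "a i = e i *\<^sub>R b i + f i *\<^sub>R b (i + 1) + g i *\<^sub>R b (i + 3)"
  using skew_cube.b_expand[OF swap] .

text \<open>Otherwise \<open>b i\<close> would lie on the line through \<open>a i\<close> and
  \<open>a (i + 3)\<close>, and the side face over the edge \<open>i + 3\<close> would be
  planar.\<close>

lemma nonzero_ahead: "u i \<noteq> 0"
proof
  assume "u i = 0"
  then have "b i = d i *\<^sub>R a i + v i *\<^sub>R a (i + 3)"
    using b_expand[of i] by simp
  also have "\<dots> \<in> span {a i, a (i + 3), b (i + 3)}"
    by (intro span_add span_scale span_base) auto
  finally have "dim {a (i + 3), a i, b (i + 3), b i} \<le> 3"
    by (intro dim_le_3_if_subset_span[of _ "a i" "a (i + 3)" "b (i + 3)"]) (auto simp: span_base)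
  then show False using skew[of "i + 3"] by simp
qed

lemma nonzero_behind: "v i \<noteq> 0"
proof
  assume "v i = 0"
  then have "b i = d i *\<^sub>R a i + u i *\<^sub>R a (i + 1)"
    using b_expand[of i] by simp
  also have "\<dots> \<in> span {a i, a (i + 1), b (i + 1)}"
    by (intro span_add span_scale span_base) auto
  finally have "dim {a i, a (i + 1), b i, b (i + 1)} \<le> 3"
    by (intro dim_le_3_if_subset_span[of _ "a i" "a (i + 1)" "b (i + 1)"]) (auto simp: span_base)
  then show False using skew[of i] by simp
qed

lemma backward:
  "e i * u i + f i * d (i + 1) = 0"
  "e i * v i + g i * d (i + 3) = 0"
  "f i * u (i + 1) + g i * v (i + 3) = 0"
proof -
  have *: "coord a j (a i) = e i * coord a j (b i) + f i * coord a j (b (i + 1))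
      + g i * coord a j (b (i + 3))" for j
    by (subst a_expand[of i]) (simp add: linear_add[OF linear_coord] linear_scale[OF linear_coord] frames)
  show "e i * u i + f i * d (i + 1) = 0"
    using *[of "i + 1"] coord_opposite[of "i + 3"] by (simp add: coord_frame frames)
  show "e i * v i + g i * d (i + 3) = 0"
    using *[of "i + 3"] coord_opposite[of "i + 1"] by (simp add: coord_frame frames)
  show "f i * u (i + 1) + g i * v (i + 3) = 0"
    using *[of "i + 2"] coord_opposite[of i] by (simp add: coord_frame frames)
qed

text \<open>Each vertex of \<open>b\<close> has no component at the opposite corner of
  \<open>a\<close>. Hence, of the two coordinates that matter for the plane, \<open>b i\<close> has
  only the one at \<open>i + 3\<close> and \<open>b (i + 1)\<close> only the one at
  \<open>i + 2\<close>.\<close>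

lemma edge_incidence:
  assumes "\<And>i. r i \<noteq> 0"
  shows "x *\<^sub>R b i + y *\<^sub>R b (i + 1) \<in> edge_span a r i
    \<longleftrightarrow> y * u (i + 1) * r (i + 3) = x * v i * r (i + 2)"
  using coord_opposite[of i] coord_opposite[of "i + 1"]
  by (simp add: edge_span_iff[OF frames(1) assms] linear_add[OF linear_coord]
      linear_scale[OF linear_coord] frames)

lemma edge_incidence_unique:
  assumes "\<And>i. r i \<noteq> 0"
    and "x *\<^sub>R b i + y *\<^sub>R b (i + 1) \<in> edge_span a r i"
    and "x' *\<^sub>R b i + y' *\<^sub>R b (i + 1) \<in> edge_span a r i"
  shows "x * y' = x' * y"
proof -
  have "y * u (i + 1) * r (i + 3) = x * v i * r (i + 2)"
    "y' * u (i + 1) * r (i + 3) = x' * v i * r (i + 2)"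
    using assms(2,3) unfolding edge_incidence[of r, OF assms(1)] by blast+
  then have "(u (i + 1) * r (i + 3)) * (x * y' - x' * y) = 0"
    by algebra
  then show ?thesis
    using nonzero_ahead[of "i + 1"] assms(1) by simp
qed

lemma edge_incidence_exists:
  assumes "\<And>i. r i \<noteq> 0"
  shows "\<exists>y. y \<noteq> 0 \<and> b i + y *\<^sub>R b (i + 1) \<in> edge_span a r i"
proof -
  define y where "y = v i * r (i + 2) / (u (i + 1) * r (i + 3))"
  have "y \<noteq> 0" "y * u (i + 1) * r (i + 3) = v i * r (i + 2)"
    using nonzero_ahead[of "i + 1"] nonzero_behind[of i] assms by (simp_all add: y_def)
  then show ?thesis
    using edge_incidence[of r 1 i y] assms by auto
qed

text \<open>Together with \<open>a i\<close>, the edge of \<open>b\<close> and the old cross vertex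
  span \<open>a (i + 1)\<close> as well, hence the whole skew side face; so they are independent and
  determine the plane.\<close>

lemma edge_span_eq:
  assumes "\<And>i. r i \<noteq> 0" "\<And>i. s i \<noteq> 0" "cross_pt a r i \<in> edge_span b s i"
  shows "edge_span b s i = span {b i, b (i + 1), cross_pt a r i}"
proof (rule span_triple_eqI)
  have "dim (edge_span b s i) \<le> 3"
    using dim_le_3_if_subset_span[OF order_refl] by (simp add: edge_span_def)
  then show "edge_span b s i \<noteq> UNIV"
    by auto
  show "dim {b i, b (i + 1), cross_pt a r i, a i} = 4"
  proof (rule dim_4I)
    have "a (i + 1) \<in> span {b i, b (i + 1), cross_pt a r i, a i}"
      by (rule in_span_pairI[of "cross_pt a r i" "r (i + 1)" _ "r i" "a i"])
        (use assms in \<open>simp_all add: cross_pt_def span_base\<close>)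
    then show "{a i, a (i + 1), b i, b (i + 1)} \<subseteq> span {b i, b (i + 1), cross_pt a r i, a i}"
      by (auto simp: span_base)
  qed (fact skew)
qed (use assms in \<open>auto simp: edge_span_def span_base\<close>)

text \<open>Both planes contain both cross vertices. These are distinct points, because with
  \<open>a i\<close> and \<open>b i\<close> they span the skew side face, and the planes differ,
  because a common plane would contain that face.\<close>

lemma cross_pts_inter:
  assumes "\<And>i. r i \<noteq> 0" "\<And>i. s i \<noteq> 0"
    and "cross_pt a r i \<in> edge_span b s i" "cross_pt b s i \<in> edge_span a r i"
  shows "span {cross_pt a r i, cross_pt b s i} = edge_span a r i \<inter> edge_span b s i"
proof (rule subspace_dim_equal)
  let ?p = "cross_pt a r i" and ?q = "cross_pt b s i"
  have own: "cross_pt c t i \<in> edge_span c t i" for c t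
    unfolding edge_span_def cross_pt_def[of c t i]
    by (intro span_add span_scale span_base) auto
  show "span {?p, ?q} \<subseteq> edge_span a r i \<inter> edge_span b s i"
    using assms(3,4) own
    by (intro span_minimal subspace_inter) (auto simp: edge_span_def)
  show sub: "subspace (edge_span a r i \<inter> edge_span b s i)"
    by (intro subspace_inter) (auto simp: edge_span_def)
  have "dim {a i, b i, ?p, ?q} = 4"
  proof (rule dim_4I)
    have "a (i + 1) \<in> span {a i, b i, ?p, ?q}"
      by (rule in_span_pairI[of "?p" "r (i + 1)" _ "r i" "a i"])
        (use assms in \<open>simp_all add: cross_pt_def span_base\<close>)
    moreover have "b (i + 1) \<in> span {a i, b i, ?p, ?q}"
      by (rule in_span_pairI[of "?q" "s (i + 1)" _ "s i" "b i"])
        (use assms in \<open>simp_all add: cross_pt_def span_base\<close>)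
    ultimately show "{a i, a (i + 1), b i, b (i + 1)} \<subseteq> span {a i, b i, ?p, ?q}"
      by (auto simp: span_base)
  qed (fact skew)
  then have pq: "2 \<le> dim {?p, ?q}"
    using dim_insert[of "a i" "{b i, ?p, ?q}"] dim_insert[of "b i" "{?p, ?q}"]
    by (simp split: if_splits)
  have "dim (edge_span a r i \<inter> edge_span b s i) \<le> 2"
  proof (rule ccontr)
    assume "\<not> ?thesis"
    then have ge: "3 \<le> dim (edge_span a r i \<inter> edge_span b s i)" by simp
    have "dim (edge_span c t i) \<le> 3" for c t
      using dim_le_3_if_subset_span[OF order_refl] by (simp add: edge_span_def)
    with ge have "edge_span a r i \<inter> edge_span b s i = edge_span a r i"
      "edge_span a r i \<inter> edge_span b s i = edge_span b s i"
      using sub by (intro subspace_dim_equal; force simp: edge_span_def intro: order_trans)+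
    then have "edge_span a r i = edge_span b s i" by simp
    then have "{a i, a (i + 1), b i, b (i + 1)} \<subseteq> edge_span a r i"
      by (metis edge_span_def insert_subset span_superset subset_insertI2 empty_subsetI span_base insertI1 insertI2)
    then have "dim {a i, a (i + 1), b i, b (i + 1)} \<le> 3"
      unfolding edge_span_def by (rule dim_le_3_if_subset_span)
    then show False using skew[of i] by simp
  qed
  with pq show "dim (edge_span a r i \<inter> edge_span b s i) \<le> dim (span {?p, ?q})"
    by simp
qed simp

end

text \<open>If all \<open>d i\<close> vanished, each \<open>b i\<close> would lie on the diagonal
  line through \<open>a (i + 1)\<close> and \<open>a (i + 3)\<close>: this is the cube on two
  lines.\<close>

locale generic_skew_cube = skew_cube +
  assumes generic: "\<exists>i. d i \<noteq> 0"
begin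

sublocale reduced_cube d u v e f g
proof
  show "u i \<noteq> 0" "v i \<noteq> 0" "f i \<noteq> 0" "g i \<noteq> 0" for i
    using nonzero_ahead nonzero_behind skew_cube.nonzero_ahead[OF swap] skew_cube.nonzero_behind[OF swap]
    by auto
qed (use backward skew_cube.backward[OF swap] generic in auto)

lemma edge_incidence_closed:
  assumes "\<And>i. r i \<noteq> 0"
  obtains s where "\<And>i. s i \<noteq> 0" "\<And>i. cross_pt b s i \<in> edge_span a r i"
proof -
  obtain s where s: "\<And>i. s i \<noteq> 0"
    "\<And>i. s (i + 1) * u (i + 1) * r (i + 3) = s i * v i * r (i + 2)"
    using cyclic_solution[of r, OF assms] by blast
  have "cross_pt b s i \<in> edge_span a r i" for i
    unfolding cross_pt_def edge_incidence[of r, OF assms] by (rule s)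
  with s(1) that show ?thesis by blast
qed

lemma edge_incidence_swap:
  assumes r: "\<And>i. r i \<noteq> 0" and s: "\<And>i. s i \<noteq> 0"
    and "\<And>i. cross_pt b s i \<in> edge_span a r i"
  shows "cross_pt a r i \<in> edge_span b s i"
proof -
  \<comment> \<open>The incidence is taken on the opposite edge \<open>i + 2\<close>, since its
    equation involves the old weights at \<open>i\<close> and \<open>i + 1\<close>.\<close>
  have "s (i + 3) * u (i + 3) * r (i + 1) = s (i + 2) * v (i + 2) * r i"
    using assms(3)[of "i + 2"] unfolding cross_pt_def edge_incidence[of r, OF r] by simp
  then have "u (i + 3) * (r (i + 1) * f (i + 1) * s (i + 3) - r i * g i * s (i + 2)) = 0"
    using cube_relation[of i] by algebra
  then have "r (i + 1) * f (i + 1) * s (i + 3) = r i * g i * s (i + 2)"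
    using nonzero(1)[of "i + 3"] by simp
  then show ?thesis
    unfolding cross_pt_def skew_cube.edge_incidence[OF swap, of s, OF s] .
qed

end

subsection \<open>Hyperboloids and the C1-condition\<close>

lemma proportional_if_same_kernel:
  fixes f g :: "'a::real_vector \<Rightarrow> real"
  assumes "linear f" "linear g" and ker: "{y. f y = 0} = {y. g y = 0}"
  obtains c where "\<And>y. f y = c * g y"
proof (cases "\<exists>y. g y \<noteq> 0")
  case True
  then obtain y0 where y0: "g y0 \<noteq> 0" by blast
  have "f y = f y0 / g y0 * g y" for y
  proof -
    have "g (y - (g y / g y0) *\<^sub>R y0) = 0"
      using y0 assms(2) by (simp add: linear_diff linear_scale)
    then have "f (y - (g y / g y0) *\<^sub>R y0) = 0"
      using ker by blast
    then show ?thesis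
      using y0 assms(1) by (simp add: linear_diff linear_scale field_simps)
  qed
  then show ?thesis using that by blast
next
  case False
  then have "f y = 0 * g y" for y
    using ker by auto
  then show ?thesis using that by blast
qed

context
  fixes B :: "hpoint \<Rightarrow> hpoint \<Rightarrow> real"
  assumes B: "nondegenerate_quadric B"
begin

lemma quadric_bilinear: "bilinear B" and quadric_sym: "B p q = B q p"
  and quadric_nondegenerate: "(\<And>q. B p q = 0) \<Longrightarrow> p = 0"
  using B by (auto simp: nondegenerate_quadric_def simp del: split_paired_All)

lemmas quadric_simps =
  bilinear_ladd[OF quadric_bilinear] bilinear_radd[OF quadric_bilinear]
  bilinear_lmul[OF quadric_bilinear] bilinear_rmul[OF quadric_bilinear]

lemma linear_quadric: "linear (B p)"
  using quadric_bilinear by (simp add: bilinear_def del: split_paired_All)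

lemma subspace_tangent_plane: "subspace (tangent_plane B p)"
  unfolding tangent_plane_def using linear_quadric[of p] by (rule linear_subspace_kernel)

lemma tangent_plane_neq_UNIV: "p \<noteq> 0 \<Longrightarrow> tangent_plane B p \<noteq> UNIV"
  using quadric_nondegenerate[of p] by (auto simp: tangent_plane_def)

text \<open>Polarisation: a symmetric form that vanishes on the diagonal of a subspace vanishes
  there altogether.\<close>

lemma contains_subspace_orthogonal:
  assumes "contains_subspace B S" "subspace S" "p \<in> S" "q \<in> S"
  shows "B p q = 0"
proof -
  have "B p p = 0" "B q q = 0" "B (p + q) (p + q) = 0"
    using assms by (auto simp: contains_subspace_def subspace_add)
  then show ?thesis
    using quadric_sym[of p q] by (simp add: quadric_simps)
qed

end

text \<open>Equal tangent planes at \<open>p\<close> mean that \<open>B p\<close> and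
  \<open>B' p\<close> are proportional. As \<open>B'\<close> is nondegenerate, the factor at the
  third point must equal those at \<open>u\<close> and \<open>v\<close>, so a single factor serves
  the whole line.\<close>

lemma tangent_planes_agree_on_line:
  assumes B: "nondegenerate_quadric B" and B': "nondegenerate_quadric B'"
    and uv: "\<And>x y. x *\<^sub>R u + y *\<^sub>R v = 0 \<Longrightarrow> x = 0 \<and> y = 0"
    and st: "s \<noteq> 0" "t \<noteq> 0"
    and tu: "tangent_plane B u = tangent_plane B' u"
    and tv: "tangent_plane B v = tangent_plane B' v"
    and tuv: "tangent_plane B (s *\<^sub>R u + t *\<^sub>R v) = tangent_plane B' (s *\<^sub>R u + t *\<^sub>R v)"
    and q: "q \<in> span {u, v}" "q \<noteq> 0"
  shows "tangent_plane B q = tangent_plane B' q"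
proof -
  have proportional: "\<exists>c. \<forall>y. B p y = c * B' p y" if "tangent_plane B p = tangent_plane B' p" for p
    using that proportional_if_same_kernel[OF linear_quadric[OF B] linear_quadric[OF B'], of p p]
    unfolding tangent_plane_def by metis
  obtain k where k: "\<And>y. B u y = k * B' u y" using proportional[OF tu] by blast
  obtain l where l: "\<And>y. B v y = l * B' v y" using proportional[OF tv] by blast
  obtain m where m: "\<And>y. B (s *\<^sub>R u + t *\<^sub>R v) y = m * B' (s *\<^sub>R u + t *\<^sub>R v) y"
    using proportional[OF tuv] by blast
  have "B' ((s * (m - k)) *\<^sub>R u + (t * (m - l)) *\<^sub>R v) y = 0" for y
  proof -
    have "s * (k * B' u y) + t * (l * B' v y) = m * (s * B' u y + t * B' v y)"
      using m[of y] by (simp add: quadric_simps[OF B] quadric_simps[OF B'] k l)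
    then have "s * (m - k) * B' u y + t * (m - l) * B' v y = 0"
      by algebra
    then show ?thesis
      by (simp add: quadric_simps[OF B'])
  qed
  then have "(s * (m - k)) *\<^sub>R u + (t * (m - l)) *\<^sub>R v = 0"
    using quadric_nondegenerate[OF B'] by blast
  then have kl: "k = m" "l = m"
    using uv st by force+
  obtain x y where xy: "q = x *\<^sub>R u + y *\<^sub>R v"
    using q(1) by (auto simp: span_breakdown_eq)
      (metis add.commute diff_add_cancel)
  have Bq: "B q w = m * B' q w" for w
    by (simp add: xy quadric_simps[OF B] quadric_simps[OF B'] k l kl algebra_simps)
  have "m \<noteq> 0"
    using quadric_nondegenerate[OF B, of q] Bq q(2) by auto
  then show ?thesis
    by (simp add: tangent_plane_def Bq)
qed

text \<open>Ranging over all \<open>i\<close> lists each of the two cross lines twice, which makes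
  the condition invariant under cyclic shifts.\<close>

definition cross_quadric :: "(4 \<Rightarrow> hpoint) \<Rightarrow> (4 \<Rightarrow> real) \<Rightarrow> (hpoint \<Rightarrow> hpoint \<Rightarrow> real) \<Rightarrow> bool" where
  "cross_quadric a r B \<longleftrightarrow> nondegenerate_quadric B \<and>
     (\<forall>i. contains_subspace B (span {a i, a (i + 1)})) \<and>
     (\<forall>i. contains_subspace B (span {cross_pt a r i, cross_pt a r (i + 2)}))"

lemma cross_quadric_iff_cross_hyperboloid:
  "cross_hyperboloid X (cross_pt (\<lambda>i. pt (X i)) r) B \<longleftrightarrow> cross_quadric (\<lambda>i. pt (X i)) r B"
proof -
  have "(\<forall>i. P i) \<longleftrightarrow> P 1 \<and> P 2" if "\<And>i. P (i + 2) = P i" for P :: "4 \<Rightarrow> bool"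
    using that[of 1] that[of 2] by (simp add: forall_4) blast
  from this[of "\<lambda>i. contains_subspace B (span {cross_pt (\<lambda>i. pt (X i)) r i, cross_pt (\<lambda>i. pt (X i)) r (i + 2)})"]
  show ?thesis
    by (simp add: cross_hyperboloid_def cross_quadric_def insert_commute)
qed

section \<open>The hyperboloid of a cross and its tangent planes\<close>

lemma cross_pt_in_edge: "cross_pt a r i \<in> span {a i, a (i + 1)}"
  unfolding cross_pt_def by (intro span_add span_scale span_base) auto

lemma cross_pt_nonzero:
  assumes "frame a" "r i \<noteq> 0"
  shows "cross_pt a r i \<noteq> 0"
proof
  assume "cross_pt a r i = 0"
  then have "coord a i (r i *\<^sub>R a i + r (i + 1) *\<^sub>R a (i + 1)) = 0"
    by (simp add: cross_pt_def linear_0[OF linear_coord[OF assms(1)]])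
  then show False
    using assms by (simp add: coord_simps)
qed

context
  fixes a r B
  assumes frame: "frame a" and r: "\<And>i. r i \<noteq> 0" and B: "cross_quadric a r B"
begin

lemma cross_quadric_nondegenerate: "nondegenerate_quadric B"
  using B by (simp add: cross_quadric_def)

lemma cross_quadric_edge: "B p q = 0" if "p \<in> span {a i, a (i + 1)}" "q \<in> span {a i, a (i + 1)}"
  by (rule contains_subspace_orthogonal[OF cross_quadric_nondegenerate _ subspace_span that])
    (use B in \<open>simp add: cross_quadric_def\<close>)

lemma cross_quadric_cross: "B (cross_pt a r i) (cross_pt a r (i + 2)) = 0"
  by (rule contains_subspace_orthogonal[OF cross_quadric_nondegenerate _ subspace_span[of "{cross_pt a r i, cross_pt a r (i + 2)}"]])
    (use B in \<open>auto simp: cross_quadric_def span_base\<close>)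

lemma tangent_plane_vertex: "tangent_plane B (a i) = span {a (i + 3), a i, a (i + 1)}"
proof (rule span_triple_eqI)
  show "dim {a (i + 3), a i, a (i + 1), a (i + 2)} = 4"
    by (rule dim_frame[OF frame])
  have "a i \<noteq> 0"
    using coord_frame[OF frame, of i i] linear_0[OF linear_coord[OF frame]] by force
  then show "tangent_plane B (a i) \<noteq> UNIV"
    by (rule tangent_plane_neq_UNIV[OF cross_quadric_nondegenerate])
  show "{a (i + 3), a i, a (i + 1)} \<subseteq> tangent_plane B (a i)"
    using cross_quadric_edge[of "a i" i] cross_quadric_edge[of "a i" "i + 3"]
    by (auto simp: tangent_plane_def span_base)
qed (rule subspace_tangent_plane[OF cross_quadric_nondegenerate])

text \<open>The two rulings through the cross vertex are the edge line and the line to the opposite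
  cross vertex; they span the tangent plane.\<close>

lemma tangent_plane_cross_pt: "tangent_plane B (cross_pt a r i) = edge_span a r i"
  unfolding edge_span_def
proof (rule span_triple_eqI)
  let ?S = "{a i, a (i + 1), cross_pt a r (i + 2), a (i + 3)}"
  show "dim ?S = 4"
  proof (rule dim_4I)
    have "a (i + 2) \<in> span ?S"
      by (rule in_span_pairI[of "cross_pt a r (i + 2)" "r (i + 2)" _ "r (i + 3)" "a (i + 3)"])
        (use r in \<open>simp_all add: cross_pt_def span_base\<close>)
    then show "{a (i + 3), a i, a (i + 1), a (i + 2)} \<subseteq> span ?S"
      by (auto simp: span_base)
  qed (rule dim_frame[OF frame])
  show "tangent_plane B (cross_pt a r i) \<noteq> UNIV"
    by (rule tangent_plane_neq_UNIV[OF cross_quadric_nondegenerate cross_pt_nonzero[OF frame r]])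
  show "{a i, a (i + 1), cross_pt a r (i + 2)} \<subseteq> tangent_plane B (cross_pt a r i)"
    using cross_quadric_edge[of "cross_pt a r i" i] cross_pt_in_edge[of a r i] cross_quadric_cross
    by (auto simp: tangent_plane_def span_base)
qed (rule subspace_tangent_plane[OF cross_quadric_nondegenerate])

end

lemma cross_quadric_exists:
  assumes frame: "frame a" and r: "\<And>i. r i \<noteq> 0"
  obtains B where "cross_quadric a r B"
proof
  let ?c = "coord a"
  \<comment> \<open>Containing the four edges leaves only the products of opposite coordinates.
    Orthogonality of opposite cross vertices then fixes the ratio of the two coefficients.\<close>
  define B where "B p q = r 2 * r 0 * (?c 1 p * ?c 3 q + ?c 3 p * ?c 1 q)
    - r 1 * r 3 * (?c 2 p * ?c 0 q + ?c 0 p * ?c 2 q)" for p q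
  note simps = coord_simps[of a, OF frame]
  have "bilinear B"
    unfolding bilinear_def B_def
    by (intro conjI allI linearI) (simp_all add: simps algebra_simps)
  moreover have "p = 0" if "\<And>q. B p q = 0" for p
  proof -
    have "?c 3 p = 0" "?c 1 p = 0" "?c 0 p = 0" "?c 2 p = 0"
      using that[of "a 1"] that[of "a 3"] that[of "a 2"] that[of "a 0"] r
      by (simp_all add: B_def simps)
    then show ?thesis
      using coord_expand[OF frame, of p 0] by simp
  qed
  moreover have "B p q = B q p" for p q
    by (simp add: B_def algebra_simps)
  ultimately have nd: "nondegenerate_quadric B"
    by (auto simp: nondegenerate_quadric_def)
  have contains: "contains_subspace B (span {p, q})" if "B p p = 0" "B q q = 0" "B p q = 0" for p q
    unfolding contains_subspace_def
  proof
    fix y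
    assume "y \<in> span {p, q}"
    then obtain s t where y: "y = s *\<^sub>R p + t *\<^sub>R q"
      by (auto simp: span_breakdown_eq) (metis add.commute diff_add_cancel)
    show "B y y = 0"
      using that quadric_sym[OF nd, of q p] by (simp add: y quadric_simps[OF nd])
  qed
  show "cross_quadric a r B"
    unfolding cross_quadric_def
  proof (intro conjI nd allI contains)
    fix i :: 4
    show "B (a i) (a i) = 0" "B (a (i + 1)) (a (i + 1)) = 0" "B (a i) (a (i + 1)) = 0"
      using exhaust_4[of i] by (elim disjE; simp add: B_def simps)+
    show "B (cross_pt a r i) (cross_pt a r i) = 0"
      "B (cross_pt a r (i + 2)) (cross_pt a r (i + 2)) = 0"
      "B (cross_pt a r i) (cross_pt a r (i + 2)) = 0"
      using exhaust_4[of i] by (elim disjE; simp add: B_def cross_pt_def simps)+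
  qed
qed

text \<open>The edge \<open>i\<close> of \<open>a\<close> is the edge \<open>i + 2\<close> of
  \<open>a'\<close>, run through backwards. The tangent planes at its endpoints are the shared
  vertex planes, so agreement at the common cross vertex, a third point, decides agreement along the
  edge.\<close>

lemma cross_quadrics_tangent_iff:
  assumes frame: "frame a" "frame a'" and r: "\<And>i. r i \<noteq> 0" "\<And>i. r' i \<noteq> 0"
    and common: "a i = a' (i + 3)" "a (i + 1) = a' (i + 2)" "r i = r' (i + 3)" "r (i + 1) = r' (i + 2)"
    and star: "span {a (i + 3), a i, a (i + 1)} = span {a' (i + 2), a' (i + 3), a' i}"
      "span {a i, a (i + 1), a (i + 2)} = span {a' (i + 1), a' (i + 2), a' (i + 3)}"
  shows "(\<exists>B B'. cross_quadric a r B \<and> cross_quadric a' r' B' \<and>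
      (\<forall>q \<in> span {a i, a (i + 1)} - {0}. tangent_plane B q = tangent_plane B' q))
    \<longleftrightarrow> edge_span a r i = edge_span a' r' (i + 2)"
proof -
  have cross: "cross_pt a r i = cross_pt a' r' (i + 2)"
    by (simp add: cross_pt_def common)
  show ?thesis
  proof
    assume "\<exists>B B'. cross_quadric a r B \<and> cross_quadric a' r' B' \<and>
      (\<forall>q \<in> span {a i, a (i + 1)} - {0}. tangent_plane B q = tangent_plane B' q)"
    then obtain B B' where B: "cross_quadric a r B" "cross_quadric a' r' B'"
      and "\<forall>q \<in> span {a i, a (i + 1)} - {0}. tangent_plane B q = tangent_plane B' q"
      by blast
    then have "tangent_plane B (cross_pt a r i) = tangent_plane B' (cross_pt a r i)"
      using cross_pt_in_edge[of a r i] cross_pt_nonzero[OF frame(1) r(1)] by auto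
    then show "edge_span a r i = edge_span a' r' (i + 2)"
      using tangent_plane_cross_pt[of a r, OF frame(1) r(1) B(1), of i]
        tangent_plane_cross_pt[of a' r', OF frame(2) r(2) B(2), of "i + 2"] cross by simp
  next
    assume eq: "edge_span a r i = edge_span a' r' (i + 2)"
    obtain B where B: "cross_quadric a r B"
      using cross_quadric_exists[of a r] frame(1) r(1) by blast
    obtain B' where B': "cross_quadric a' r' B'"
      using cross_quadric_exists[of a' r'] frame(2) r(2) by blast
    note tangent = tangent_plane_vertex[of a r, OF frame(1) r(1) B] tangent_plane_cross_pt[of a r, OF frame(1) r(1) B]
    note tangent' = tangent_plane_vertex[of a' r', OF frame(2) r(2) B'] tangent_plane_cross_pt[of a' r', OF frame(2) r(2) B']
    have "tangent_plane B q = tangent_plane B' q" if "q \<in> span {a i, a (i + 1)} - {0}" for q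
    proof (rule tangent_planes_agree_on_line[where u = "a i" and v = "a (i + 1)" and s = "r i" and t = "r (i + 1)"])
      show "nondegenerate_quadric B" "nondegenerate_quadric B'"
        using B B' by (simp_all add: cross_quadric_def)
      show "x = 0 \<and> y = 0" if "x *\<^sub>R a i + y *\<^sub>R a (i + 1) = 0" for x y
      proof -
        have "coord a j (x *\<^sub>R a i + y *\<^sub>R a (i + 1)) = 0" for j
          using that linear_0[OF linear_coord[OF frame(1)]] by simp
        from this[of i] this[of "i + 1"] show ?thesis
          by (simp add: coord_simps frame)
      qed
      show "tangent_plane B (a i) = tangent_plane B' (a i)"
        using tangent(1)[of i] tangent'(1)[of "i + 3"] star by (simp add: common)
      show "tangent_plane B (a (i + 1)) = tangent_plane B' (a (i + 1))"
        using tangent(1)[of "i + 1"] tangent'(1)[of "i + 2"] star by (simp add: common)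
      show "tangent_plane B (r i *\<^sub>R a i + r (i + 1) *\<^sub>R a (i + 1))
          = tangent_plane B' (r i *\<^sub>R a i + r (i + 1) *\<^sub>R a (i + 1))"
        using tangent(2)[of i] tangent'(2)[of "i + 2"] eq cross by (simp add: cross_pt_def)
    qed (use that r in auto)
    with B B' show "\<exists>B B'. cross_quadric a r B \<and> cross_quadric a' r' B' \<and>
        (\<forall>q \<in> span {a i, a (i + 1)} - {0}. tangent_plane B q = tangent_plane B' q)"
      by blast
  qed
qed

subsection \<open>Crosses and cubes of nets\<close>

declare split_paired_All [simp del]

lemma corner_simps: "corner z 0 = z + (0, 1)" "corner z 1 = z" "corner z 2 = z + (1, 0)"
  "corner z 3 = z + (1, 1)"
  by (simp_all add: corner_def zero_prod_def[symmetric])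

lemma range_4: "range f = {f 0, f 1, f 2, f 3}" for f :: "4 \<Rightarrow> 'a"
  by (auto simp: UNIV_4)

abbreviation hquad :: "(int \<times> int \<Rightarrow> point) \<Rightarrow> int \<times> int \<Rightarrow> 4 \<Rightarrow> hpoint" where
  "hquad x z \<equiv> \<lambda>i. pt (quad x z i)"

abbreviation weights :: "(int \<times> int \<Rightarrow> real) \<Rightarrow> int \<times> int \<Rightarrow> 4 \<Rightarrow> real" where
  "weights \<rho> z \<equiv> \<lambda>i. \<rho> (corner z i)"

lemma net_cross_eq: "net_cross x \<rho> z = cross_pt (hquad x z) (weights \<rho> z)"
  by (simp add: fun_eq_iff net_cross_def cross_vertex_def cross_pt_def quad_def)

lemma frame_hquad: "a_surface x \<Longrightarrow> frame (hquad x z)"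
  by (simp add: frame_iff_not_coplanar a_surface_def)

lemma adapted_cross_pt:
  assumes "frame (\<lambda>i. pt (X i))" "\<And>i. r i \<noteq> 0"
  shows "adapted_cross X (cross_pt (\<lambda>i. pt (X i)) r)"
  unfolding adapted_cross_def
proof (intro conjI allI)
  let ?a = "\<lambda>i. pt (X i)"
  note coords = coord_simps[of ?a, OF assms(1)]
  fix i
  show "cross_pt ?a r i \<in> span {pt (X i), pt (X (i + 1))}"
    by (rule cross_pt_in_edge)
  show "cross_pt ?a r i \<notin> span {pt (X i)}"
  proof
    assume "cross_pt ?a r i \<in> span {pt (X i)}"
    then obtain k where "cross_pt ?a r i = k *\<^sub>R pt (X i)"
      by (auto simp: span_singleton)
    then have "coord ?a (i + 1) (cross_pt ?a r i) = coord ?a (i + 1) (k *\<^sub>R pt (X i))"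
      by simp
    then show False
      using assms(2) by (simp add: cross_pt_def coords)
  qed
  show "cross_pt ?a r i \<notin> span {pt (X (i + 1))}"
  proof
    assume "cross_pt ?a r i \<in> span {pt (X (i + 1))}"
    then obtain k where "cross_pt ?a r i = k *\<^sub>R pt (X (i + 1))"
      by (auto simp: span_singleton)
    then have "coord ?a i (cross_pt ?a r i) = coord ?a i (k *\<^sub>R pt (X (i + 1)))"
      by simp
    then show False
      using assms(2) by (simp add: cross_pt_def coords)
  qed
next
  let ?p = "cross_pt (\<lambda>i. pt (X i)) r"
  \<comment> \<open>In the alternating sum of the cross vertices each weighted corner occurs twice
    with opposite signs.\<close>
  have "?p 0 = ?p 1 - ?p 2 + ?p 3"
    by (simp add: cross_pt_def)
  also have "\<dots> \<in> span {?p 1, ?p 2, ?p 3}"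
    by (intro span_add span_diff span_base) auto
  finally have "dim (range ?p) \<le> 3"
    by (intro dim_le_3_if_subset_span) (auto simp: range_4 span_base)
  then show "dim (span (range ?p)) \<le> 3"
    by simp
qed

lemma crisscrossed_iff: "crisscrossed x \<rho> \<longleftrightarrow> a_surface x \<and> (\<forall>z. \<rho> z \<noteq> 0)"
proof -
  have "adapted_cross (quad x z) (net_cross x \<rho> z)" if "a_surface x" "\<forall>z. \<rho> z \<noteq> 0" for z
    unfolding net_cross_eq using that by (intro adapted_cross_pt frame_hquad) auto
  then show ?thesis
    by (auto simp: crisscrossed_def)
qed

text \<open>Skewness makes the corner and its two neighbours independent. The vertex plane can thus
  be read off from each of the four quadrilaterals at a vertex.\<close>

lemma vertex_plane_corner:
  assumes "a_surface x"
  shows "vertex_plane x (corner z i) = span {hquad x z (i + 3), hquad x z i, hquad x z (i + 1)}"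
proof (rule span_triple_eqI)
  let ?S = "x ` star (corner z i)"
  show "subspace (vertex_plane x (corner z i))"
    by (simp add: vertex_plane_def)
  have fin: "finite ?S"
    by (simp add: star_def)
  have "coplanar ?S"
    using assms by (simp add: a_surface_def)
  then have "dim (vertex_plane x (corner z i)) \<le> 3"
    using coplanar_iff_dim[OF fin] by (simp add: vertex_plane_def)
  then show "vertex_plane x (corner z i) \<noteq> UNIV"
    by auto
  have "corner z i \<in> star (corner z i)" "corner z (i + 1) \<in> star (corner z i)"
    "corner z (i + 3) \<in> star (corner z i)"
    using exhaust_4[of i] by (elim disjE; cases z; simp add: corner_simps star_def)+
  then show "{hquad x z (i + 3), hquad x z i, hquad x z (i + 1)} \<subseteq> vertex_plane x (corner z i)"
    unfolding vertex_plane_def quad_def by (blast intro: span_base)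
  show "dim {hquad x z (i + 3), hquad x z i, hquad x z (i + 1), hquad x z (i + 2)} = 4"
    by (rule dim_frame[OF frame_hquad[OF assms]])
qed

lemma c1_condition_iff:
  assumes x: "a_surface x" and \<rho>: "\<And>z. \<rho> z \<noteq> 0"
    and adjacent: "corner z i = corner z' (i + 3)" "corner z (i + 1) = corner z' (i + 2)"
      "range (corner z) \<inter> range (corner z') = {corner z i, corner z (i + 1)}"
  shows "c1_condition x \<rho> z z' \<longleftrightarrow>
    edge_span (hquad x z) (weights \<rho> z) i = edge_span (hquad x z') (weights \<rho> z') (i + 2)"
proof -
  have "pt ` x ` (range (corner z) \<inter> range (corner z')) = {hquad x z i, hquad x z (i + 1)}"
    unfolding adjacent(3) by (simp add: quad_def)
  moreover have "span {hquad x z (i + 3), hquad x z i, hquad x z (i + 1)}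
      = span {hquad x z' (i + 2), hquad x z' (i + 3), hquad x z' i}"
    using vertex_plane_corner[OF x, of z i] vertex_plane_corner[OF x, of z' "i + 3"] adjacent by simp
  moreover have "span {hquad x z i, hquad x z (i + 1), hquad x z (i + 2)}
      = span {hquad x z' (i + 1), hquad x z' (i + 2), hquad x z' (i + 3)}"
    using vertex_plane_corner[OF x, of z "i + 1"] vertex_plane_corner[OF x, of z' "i + 2"] adjacent by simp
  moreover have "hquad x z i = hquad x z' (i + 3)" "hquad x z (i + 1) = hquad x z' (i + 2)"
    using adjacent by (simp_all add: quad_def)
  ultimately show ?thesis
    unfolding c1_condition_def net_cross_eq cross_quadric_iff_cross_hyperboloid
    using cross_quadrics_tangent_iff[OF frame_hquad[OF x, of z] frame_hquad[OF x, of z'],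
        of "weights \<rho> z" "weights \<rho> z'" i] adjacent \<rho>
    by simp
qed

text \<open>The edges 0, 1, 2, 3 are the left, lower, right and upper one. The sums of indices stay
  unreduced to match the hypotheses of \<open>c1_condition_iff\<close>.\<close>

lemma adjacent_right:
  "corner z 2 = corner (z + (1, 0)) (2 + 3)" "corner z (2 + 1) = corner (z + (1, 0)) (2 + 2)"
  "range (corner z) \<inter> range (corner (z + (1, 0))) = {corner z 2, corner z (2 + 1)}"
  by (cases z; auto simp: corner_simps range_4)+

lemma adjacent_above:
  "corner z 3 = corner (z + (0, 1)) (3 + 3)" "corner z (3 + 1) = corner (z + (0, 1)) (3 + 2)"
  "range (corner z) \<inter> range (corner (z + (0, 1))) = {corner z 3, corner z (3 + 1)}"
  by (cases z; auto simp: corner_simps range_4)+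

lemma pre_hyperbolic_iff:
  "pre_hyperbolic x \<rho> \<longleftrightarrow> a_surface x \<and> (\<forall>z. \<rho> z \<noteq> 0) \<and>
    (\<forall>z. edge_span (hquad x z) (weights \<rho> z) 2
       = edge_span (hquad x (z + (1, 0))) (weights \<rho> (z + (1, 0))) 0) \<and>
    (\<forall>z. edge_span (hquad x z) (weights \<rho> z) 3
       = edge_span (hquad x (z + (0, 1))) (weights \<rho> (z + (0, 1))) 1)"
proof -
  have "(\<forall>z. \<forall>d\<in>{(1, 0), (0, 1)}. c1_condition x \<rho> z (z + d)) \<longleftrightarrow>
    (\<forall>z. edge_span (hquad x z) (weights \<rho> z) 2
       = edge_span (hquad x (z + (1, 0))) (weights \<rho> (z + (1, 0))) 0) \<and>
    (\<forall>z. edge_span (hquad x z) (weights \<rho> z) 3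
       = edge_span (hquad x (z + (0, 1))) (weights \<rho> (z + (0, 1))) 1)"
    if "a_surface x" "\<forall>z. \<rho> z \<noteq> 0"
    using c1_condition_iff[OF that(1) _ adjacent_right, of \<rho>]
      c1_condition_iff[OF that(1) _ adjacent_above, of \<rho>] that(2)
    by simp blast
  then show ?thesis
    unfolding pre_hyperbolic_def crisscrossed_iff by blast
qed

section \<open>A-cubes and Weingarten cubes in coordinates\<close>

lemma skew_cube_if_a_cube:
  assumes "a_cube X Xt"
  shows "skew_cube (\<lambda>i. pt (X i)) (\<lambda>i. pt (Xt i))"
proof
  let ?a = "\<lambda>i. pt (X i)" and ?b = "\<lambda>i. pt (Xt i)"
  show fr: "frame ?a" "frame ?b"
    using assms by (auto simp: a_cube_def frame_iff_not_coplanar)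
  fix i
  have in_span: "v \<in> span {c (i + 3), c i, c (i + 1)}"
    if "frame c" "dim {c i, c (i + 1), c (i + 3), v} \<le> 3" for c v
  proof (rule ccontr)
    assume "\<not> ?thesis"
    then have "dim {c (i + 3), c i, c (i + 1)} \<le> 2"
      using that(2) dim_insert[of v "{c (i + 3), c i, c (i + 1)}"] by (simp add: insert_commute)
    then show False
      using dim_frame[OF that(1), of i] dim_insert[of "c (i + 2)" "{c (i + 3), c i, c (i + 1)}"]
      by (simp add: insert_commute split: if_splits)
  qed
  have "coplanar {X i, X (i + 1), X (i - 1), Xt i}" "coplanar {Xt i, Xt (i + 1), Xt (i - 1), X i}"
    using assms by (auto simp: a_cube_def)
  then show "?b i \<in> span {?a (i + 3), ?a i, ?a (i + 1)}" "?a i \<in> span {?b (i + 3), ?b i, ?b (i + 1)}"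
    by (intro in_span fr; simp add: coplanar_iff_dim)+
  have "\<not> coplanar {X i, X (i + 1), Xt (i + 1), Xt i}"
    using assms by (auto simp: a_cube_def)
  then show "dim {?a i, ?a (i + 1), ?b i, ?b (i + 1)} = 4"
    by (simp add: not_coplanar_iff_dim insert_commute)
qed

lemma generic_skew_cube_if_a_cube:
  assumes "a_cube X Xt" "\<not> two_line_cube X Xt"
  shows "generic_skew_cube (\<lambda>i. pt (X i)) (\<lambda>i. pt (Xt i))"
proof -
  let ?a = "\<lambda>i. pt (X i)" and ?b = "\<lambda>i. pt (Xt i)"
  interpret skew_cube ?a ?b
    by (rule skew_cube_if_a_cube[OF assms(1)])
  show ?thesis
  proof
    show "\<exists>i. d i \<noteq> 0"
    proof (rule ccontr)
      assume *: "\<nexists>i. d i \<noteq> 0"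
      have hull: "Xt i \<in> affine hull {X (i + 1), X (i + 3)}" for i
      proof -
        have "?b i = u i *\<^sub>R ?a (i + 1) + v i *\<^sub>R ?a (i + 3)"
          using b_expand[of i] * by simp
        also have "\<dots> \<in> span (pt ` {X (i + 1), X (i + 3)})"
          by (intro span_add span_scale span_base) auto
        finally show ?thesis
          by (simp add: pt_in_span_iff del: image_insert)
      qed
      have "{X 1, X 3, Xt 2, Xt 4} \<subseteq> affine hull {X 1, X 3}"
        using hull[of 2] hull[of 0] by (auto simp: insert_commute hull_inc)
      moreover have "{X 2, X 4, Xt 1, Xt 3} \<subseteq> affine hull {X 2, X 4}"
        using hull[of 1] hull[of 3] by (auto simp: insert_commute hull_inc)
      ultimately have "two_line_cube X Xt"
        unfolding two_line_cube_def collinear_affine_hull by blast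
      with assms(2) show False ..
    qed
  qed
qed

text \<open>Incidence of the new cross vertices with the old planes implies the reverse incidence by
  \<open>edge_incidence_swap\<close>, and the two together give the intersection line by
  \<open>cross_pts_inter\<close>.\<close>

lemma weingarten_cube_iff:
  assumes cube: "a_cube X Xt" "\<not> two_line_cube X Xt"
    and r: "\<And>i. r i \<noteq> 0" and s: "\<And>i. s i \<noteq> 0"
  shows "weingarten_cube X (cross_pt (\<lambda>i. pt (X i)) r) Xt (cross_pt (\<lambda>i. pt (Xt i)) s) \<longleftrightarrow>
    (\<forall>i. cross_pt (\<lambda>i. pt (Xt i)) s i \<in> edge_span (\<lambda>i. pt (X i)) r i)"
proof -
  let ?a = "\<lambda>i. pt (X i)" and ?b = "\<lambda>i. pt (Xt i)"
  interpret generic_skew_cube ?a ?b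
    by (rule generic_skew_cube_if_a_cube[OF cube])
  have "weingarten_cube X (cross_pt ?a r) Xt (cross_pt ?b s) \<longleftrightarrow>
    (\<forall>i. span {cross_pt ?a r i, cross_pt ?b s i} = edge_span ?a r i \<inter> edge_span ?b s i)"
    using adapted_cross_pt[of X r] adapted_cross_pt[of Xt s] frames r s cube(1)
    by (simp add: weingarten_cube_def edge_span_def)
  also have "\<dots> \<longleftrightarrow> (\<forall>i. cross_pt ?b s i \<in> edge_span ?a r i)"
  proof
    assume "\<forall>i. cross_pt ?b s i \<in> edge_span ?a r i"
    then show "\<forall>i. span {cross_pt ?a r i, cross_pt ?b s i} = edge_span ?a r i \<inter> edge_span ?b s i"
      using cross_pts_inter[of r s] edge_incidence_swap[of r s] r s by blast
  next
    assume *: "\<forall>i. span {cross_pt ?a r i, cross_pt ?b s i} = edge_span ?a r i \<inter> edge_span ?b s i"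
    have "cross_pt ?b s i \<in> span {cross_pt ?a r i, cross_pt ?b s i}" for i
      by (simp add: span_base)
    with * show "\<forall>i. cross_pt ?b s i \<in> edge_span ?a r i" by blast
  qed
  finally show ?thesis .
qed

lemma a_cube_if_discrete_weingarten:
  assumes "discrete_weingarten x xt"
  shows "a_cube (quad x z) (quad xt z)"
proof -
  have x: "a_surface x" and xt: "a_surface xt"
    and line: "\<And>z. span {pt (x z), pt (xt z)} = vertex_plane x z \<inter> vertex_plane xt z"
    and side: "\<not> coplanar {x z, x (z + (1, 0)), xt (z + (1, 0)), xt z}"
      "\<not> coplanar {x z, x (z + (0, 1)), xt (z + (0, 1)), xt z}" for z
    using assms by (auto simp: discrete_weingarten_def)
  have "pt (xt z) \<in> vertex_plane x z \<and> pt (x z) \<in> vertex_plane xt z" for z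
    using line[of z] span_base[of "pt (x z)" "{pt (x z), pt (xt z)}"]
      span_base[of "pt (xt z)" "{pt (x z), pt (xt z)}"] by auto
  from this[of "corner z i" for i]
  have "hquad xt z i \<in> span {hquad x z (i + 3), hquad x z i, hquad x z (i + 1)}"
    "hquad x z i \<in> span {hquad xt z (i + 3), hquad xt z i, hquad xt z (i + 1)}" for i
    using vertex_plane_corner[OF x, of z i] vertex_plane_corner[OF xt, of z i]
    by (auto simp: quad_def)
  then have "coplanar {y z i, y z (i + 1), y z (i - 1), yt z i}"
    if "(y, yt) \<in> {(quad x, quad xt), (quad xt, quad x)}" for y yt i
    using that
    by (intro coplanar_if_subset_span[of _ "pt (y z (i + 3))" "pt (y z i)" "pt (y z (i + 1))"])
      (auto simp: span_base)
  moreover have "\<not> coplanar {quad x z i, quad x z (i + 1), quad xt z (i + 1), quad xt z i}" for i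
    \<comment> \<open>The upper and right edges are treated as the lower edge at
      \<open>z + (0, 1)\<close> and the left edge at \<open>z + (1, 0)\<close>.\<close>
    using exhaust_4[of i] side[of z] side(1)[of "z + (0, 1)"] side(2)[of "z + (1, 0)"]
    by (elim disjE) (simp_all add: quad_def corner_simps insert_commute add.assoc)
  ultimately show ?thesis
    using x xt unfolding a_cube_def a_surface_def by blast
qed

subsection \<open>Functions on the grid with prescribed edge ratios\<close>

lemma grid_add: "z + (1, 0) + (0, 1) = z + (1, 1)" "z + (0, 1) + (1, 0) = z + (1, 1)"
  for z :: "int \<times> int"
  by (simp_all add: add.assoc)

lemma int_potential:
  fixes r :: "int \<Rightarrow> real"
  assumes "\<And>n. r n \<noteq> 0"
  shows "\<exists>f. f 0 = 1 \<and> (\<forall>n. f n \<noteq> 0) \<and> (\<forall>n. f (n + 1) = r n * f n)"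
proof -
  \<comment> \<open>Partial products to the right of 0 and reciprocals of partial products to the
    left; both are empty at 0.\<close>
  define f where "f n = (if 0 \<le> n then \<Prod>k\<in>{0..<n}. r k else 1 / (\<Prod>k\<in>{n..<0}. r k))" for n
  have "f (n + 1) = r n * f n" for n
  proof (cases "0 \<le> n")
    case True
    then have "{0..<n + 1} = insert n {0..<n}" by auto
    with True show ?thesis by (simp add: f_def)
  next
    case False
    then have *: "{n..<0} = insert n {n + 1..<0}" by auto
    show ?thesis
    \<comment> \<open>Only the step from -1 to 0 passes from the reciprocals to the
      products.\<close>
    proof (cases "n = -1")
      case True
      then show ?thesis using assms[of n] * by (simp add: f_def)
    next
      case n: False
      with False have "\<not> 0 \<le> n + 1" by simp
      then show ?thesis using assms[of n] False by (simp add: f_def * field_simps)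
    qed
  qed
  moreover have "f n \<noteq> 0" for n
    using assms by (simp add: f_def)
  moreover have "f 0 = 1"
    by (simp add: f_def)
  ultimately show ?thesis by blast
qed

lemma int_shift_invariant:
  fixes P :: "int \<Rightarrow> bool"
  assumes "\<And>n. P (n + 1) \<longleftrightarrow> P n" "P 0"
  shows "P n"
proof (induction n rule: int_induct[of _ 0])
  case (step1 i)
  then show ?case using assms(1) by simp
next
  case (step2 i)
  then show ?case using assms(1)[of "i - 1"] by simp
qed (fact assms(2))

text \<open>The row through the origin is integrated first, by \<open>g\<close>, then every column
  from its value 1 on that row, by \<open>h\<close>. The vertical ratios hold by construction;
  closedness carries the horizontal ones from row to row.\<close>

lemma grid_potential:
  fixes r1 r2 :: "int \<times> int \<Rightarrow> real"
  assumes nz: "\<And>z. r1 z \<noteq> 0" "\<And>z. r2 z \<noteq> 0"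
    and closed: "\<And>z. r1 z * r2 (z + (1, 0)) = r2 z * r1 (z + (0, 1))"
  obtains f where "\<And>z. f z \<noteq> 0" "\<And>z. f (z + (1, 0)) = r1 z * f z" "\<And>z. f (z + (0, 1)) = r2 z * f z"
proof -
  obtain g where g: "\<And>m. g m \<noteq> 0" "\<And>m. g (m + 1) = r1 (m, 0) * g m"
    using int_potential[of "\<lambda>m. r1 (m, 0)"] nz by blast
  have "\<exists>h. h 0 = 1 \<and> (\<forall>n. h n \<noteq> 0) \<and> (\<forall>n. h (n + 1) = r2 (m, n) * h n)" for m
    using int_potential[of "\<lambda>n. r2 (m, n)"] nz by blast
  then obtain h where h: "\<And>m. h m 0 = 1" "\<And>m n. h m n \<noteq> 0" "\<And>m n. h m (n + 1) = r2 (m, n) * h m n"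
    by metis
  define f where "f z = g (fst z) * h (fst z) (snd z)" for z
  have "g (m + 1) * h (m + 1) n = r1 (m, n) * (g m * h m n)" for m n
  proof (induction n rule: int_shift_invariant)
    case (1 n)
    have c: "r1 (m, n) * r2 (m + 1, n) = r2 (m, n) * r1 (m, n + 1)"
      using closed[of "(m, n)"] by simp
    have "g (m + 1) * h (m + 1) (n + 1) = r1 (m, n + 1) * (g m * h m (n + 1))
      \<longleftrightarrow> r2 (m + 1, n) * (g (m + 1) * h (m + 1) n) = r2 (m, n) * r1 (m, n + 1) * (g m * h m n)"
      unfolding h(3) by (simp only: mult_ac)
    also have "\<dots> \<longleftrightarrow> r2 (m + 1, n) * (g (m + 1) * h (m + 1) n) = r2 (m + 1, n) * (r1 (m, n) * (g m * h m n))"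
      unfolding c[symmetric] by (simp only: mult_ac)
    also have "\<dots> \<longleftrightarrow> g (m + 1) * h (m + 1) n = r1 (m, n) * (g m * h m n)"
      using nz by simp
    finally show ?case .
  next
    case 2
    show ?case by (simp add: g h)
  qed
  then have "f (z + (1, 0)) = r1 z * f z" for z
    by (simp add: f_def split: prod.splits)
  moreover have "f (z + (0, 1)) = r2 z * f z" for z
    by (simp add: f_def h(3) split: prod.splits)
  moreover have "f z \<noteq> 0" for z
    by (simp add: f_def g h)
  ultimately show ?thesis using that by blast
qed

lemma grid_shift_invariant_constant:
  fixes f :: "int \<times> int \<Rightarrow> 'a"
  assumes "\<And>z. f (z + (1, 0)) = f z" "\<And>z. f (z + (0, 1)) = f z"
  shows "f z = f (0, 0)"
proof -
  have "f (m, 0) = f (0, 0)" for m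
    using assms(1)[of "(_, 0)"] by (induction m rule: int_shift_invariant) simp_all
  moreover have "f (m, n) = f (m, 0)" for m n
    using assms(2)[of "(m, _)"] by (induction n rule: int_shift_invariant) simp_all
  ultimately show ?thesis by (cases z) metis
qed

subsection \<open>Weingarten transforms\<close>

locale transformed_net =
  fixes x xt :: "int \<times> int \<Rightarrow> point" and \<rho> :: "int \<times> int \<Rightarrow> real"
  assumes pre_hyperbolic: "pre_hyperbolic x \<rho>"
    and discrete_weingarten: "discrete_weingarten x xt"
    and generic_cubes: "generic_cubes x xt"
begin

lemma a_surface_xt: "a_surface xt"
  using discrete_weingarten by (simp add: discrete_weingarten_def)

lemma \<rho>_nonzero: "\<rho> z \<noteq> 0"
  using pre_hyperbolic by (simp add: pre_hyperbolic_iff)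

lemma cube: "a_cube (quad x z) (quad xt z)" "\<not> two_line_cube (quad x z) (quad xt z)"
  using a_cube_if_discrete_weingarten[OF discrete_weingarten] generic_cubes
  by (auto simp: generic_cubes_def)

lemma generic_skew_cube: "generic_skew_cube (hquad x z) (hquad xt z)"
  by (rule generic_skew_cube_if_a_cube[OF cube])

lemma skew_cube: "skew_cube (hquad x z) (hquad xt z)"
  using generic_skew_cube by (rule generic_skew_cube.axioms(1))

abbreviation "plane z i \<equiv> edge_span (hquad x z) (weights \<rho> z) i"

lemma plane_right: "plane z 2 = plane (z + (1, 0)) 0"
  and plane_above: "plane z 3 = plane (z + (0, 1)) 1"
  using pre_hyperbolic by (auto simp: pre_hyperbolic_iff)

text \<open>A condition on the weights \<open>s\<close> at \<open>z\<close> and \<open>t\<close> at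
  the right neighbour: their cross vertex lies in the plane that \<open>x\<close> prescribes for
  this edge, read off from the quadrilateral above it.\<close>

definition horizontal :: "int \<times> int \<Rightarrow> real \<Rightarrow> real \<Rightarrow> bool" where
  "horizontal z s t \<longleftrightarrow> s *\<^sub>R pt (xt z) + t *\<^sub>R pt (xt (z + (1, 0))) \<in> plane z 1"

definition vertical :: "int \<times> int \<Rightarrow> real \<Rightarrow> real \<Rightarrow> bool" where
  "vertical z s t \<longleftrightarrow> s *\<^sub>R pt (xt z) + t *\<^sub>R pt (xt (z + (0, 1))) \<in> plane z 0"

text \<open>The right and upper edges are passed to the neighbouring quadrilateral by the
  C1-condition for \<open>x\<close>. The edges 0 and 3 run against the lattice directions, so their
  weights appear in reverse order.\<close>

lemma cross_pt_in_plane_iff: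
  "cross_pt (hquad xt z) s 0 \<in> plane z 0 \<longleftrightarrow> vertical z (s 1) (s 0)"
  "cross_pt (hquad xt z) s 1 \<in> plane z 1 \<longleftrightarrow> horizontal z (s 1) (s 2)"
  "cross_pt (hquad xt z) s 2 \<in> plane z 2 \<longleftrightarrow> vertical (z + (1, 0)) (s 2) (s 3)"
  "cross_pt (hquad xt z) s 3 \<in> plane z 3 \<longleftrightarrow> horizontal (z + (0, 1)) (s 0) (s 3)"
  unfolding plane_right plane_above
  by (simp_all add: cross_pt_def horizontal_def vertical_def quad_def corner_simps grid_add
      add.commute[of "_ *\<^sub>R _" "_ *\<^sub>R _"])

lemma scale_in_plane: "s *\<^sub>R p + t *\<^sub>R q \<in> plane z i \<Longrightarrow> (c * s) *\<^sub>R p + (c * t) *\<^sub>R q \<in> plane z i"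
  using span_scale[of "s *\<^sub>R p + t *\<^sub>R q" _ c] unfolding edge_span_def by (simp add: algebra_simps)

lemma horizontal_scale: "horizontal z s t \<Longrightarrow> horizontal z (c * s) (c * t)"
  and vertical_scale: "vertical z s t \<Longrightarrow> vertical z (c * s) (c * t)"
  unfolding horizontal_def vertical_def by (fact scale_in_plane)+

lemma horizontal_unique: "horizontal z s t \<Longrightarrow> horizontal z s' t' \<Longrightarrow> s * t' = s' * t"
  using skew_cube.edge_incidence_unique[OF skew_cube, of "weights \<rho> z" s z 1 t s' t'] \<rho>_nonzero
  by (simp add: horizontal_def quad_def corner_simps)

lemma vertical_unique: "vertical z s t \<Longrightarrow> vertical z s' t' \<Longrightarrow> s * t' = s' * t"
  using skew_cube.edge_incidence_unique[OF skew_cube, of "weights \<rho> z" t z 0 s t' s'] \<rho>_nonzero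
  by (simp add: vertical_def quad_def corner_simps add.commute mult.commute)

lemma horizontal_exists: "\<exists>t. t \<noteq> 0 \<and> horizontal z 1 t"
  using skew_cube.edge_incidence_exists[OF skew_cube, of "weights \<rho> z" z 1] \<rho>_nonzero
  by (simp add: horizontal_def quad_def corner_simps)

lemma vertical_exists: "\<exists>t. t \<noteq> 0 \<and> vertical z 1 t"
proof -
  \<comment> \<open>The edge 0 runs downwards, so this gives weight 1 at the upper end; rescaling
    moves it to \<open>z\<close>.\<close>
  obtain y where y: "y \<noteq> 0" "vertical z y 1"
    using skew_cube.edge_incidence_exists[OF skew_cube, of "weights \<rho> z" z 0] \<rho>_nonzero
    by (auto simp: vertical_def quad_def corner_simps add.commute)
  then have "vertical z 1 (1 / y)"
    using vertical_scale[of z y 1 "1 / y"] by simp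
  with y(1) show ?thesis
    by (intro exI[of _ "1 / y"]) simp
qed

text \<open>The two quadrilaterals at an edge prescribe the same plane, so the cube conditions
  reduce to one per lattice edge.\<close>

lemma corresponding_weingarten_cubes_iff:
  assumes "\<And>z. \<rho>t z \<noteq> 0"
  shows "corresponding_weingarten_cubes x \<rho> xt \<rho>t \<longleftrightarrow>
    (\<forall>z. horizontal z (\<rho>t z) (\<rho>t (z + (1, 0))) \<and> vertical z (\<rho>t z) (\<rho>t (z + (0, 1))))"
proof -
  have edges: "(\<forall>i. cross_pt (hquad xt z) (weights \<rho>t z) i \<in> plane z i) \<longleftrightarrow>
    (horizontal z (\<rho>t z) (\<rho>t (z + (1, 0))) \<and> vertical z (\<rho>t z) (\<rho>t (z + (0, 1)))) \<and>
    horizontal (z + (0, 1)) (\<rho>t (z + (0, 1))) (\<rho>t (z + (0, 1) + (1, 0))) \<and>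
    vertical (z + (1, 0)) (\<rho>t (z + (1, 0))) (\<rho>t (z + (1, 0) + (0, 1)))" for z
    by (simp add: forall_4 cross_pt_in_plane_iff corner_simps grid_add) blast
  have "corresponding_weingarten_cubes x \<rho> xt \<rho>t \<longleftrightarrow>
    (\<forall>z i. cross_pt (hquad xt z) (weights \<rho>t z) i \<in> plane z i)"
    unfolding corresponding_weingarten_cubes_def net_cross_eq
    using weingarten_cube_iff[OF cube] assms \<rho>_nonzero by simp
  also have "\<dots> \<longleftrightarrow> (\<forall>z. horizontal z (\<rho>t z) (\<rho>t (z + (1, 0))) \<and> vertical z (\<rho>t z) (\<rho>t (z + (0, 1))))"
    unfolding edges by blast
  finally show ?thesis .
qed

lemma weights_exist:
  obtains \<rho>t where "crisscrossed xt \<rho>t" "corresponding_weingarten_cubes x \<rho> xt \<rho>t"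
proof -
  obtain r1 where r1: "\<And>z. r1 z \<noteq> 0" "\<And>z. horizontal z 1 (r1 z)"
    using horizontal_exists by metis
  obtain r2 where r2: "\<And>z. r2 z \<noteq> 0" "\<And>z. vertical z 1 (r2 z)"
    using vertical_exists by metis
  have "r1 z * r2 (z + (1, 0)) = r2 z * r1 (z + (0, 1))" for z
  proof -
    interpret generic_skew_cube "hquad x z" "hquad xt z"
      by (rule generic_skew_cube)
    have ratio: "t = r1 z * s" if "horizontal z s t" for z s t
      using horizontal_unique[OF r1(2) that] by (simp add: mult.commute)
    have ratio': "t = r2 z * s" if "vertical z s t" for z s t
      using vertical_unique[OF r2(2) that] by (simp add: mult.commute)
    \<comment> \<open>One set of weights on this quadrilateral realises all four ratios; comparing
      the two ways from corner 1 to corner 3 gives the closing condition.\<close>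
    obtain s where s: "\<And>i. s i \<noteq> 0" "\<And>i. cross_pt (hquad xt z) s i \<in> plane z i"
      using edge_incidence_closed[of "weights \<rho> z"] \<rho>_nonzero by blast
    have "s 2 = r1 z * s 1" "s 3 = r2 (z + (1, 0)) * s 2" "s 3 = r1 (z + (0, 1)) * s 0" "s 0 = r2 z * s 1"
      using s(2)[of 0] s(2)[of 1] s(2)[of 2] s(2)[of 3]
      unfolding cross_pt_in_plane_iff by (auto intro: ratio ratio')
    then have "s 1 * (r1 z * r2 (z + (1, 0))) = s 1 * (r2 z * r1 (z + (0, 1)))"
      by algebra
    then show ?thesis
      using s(1)[of 1] by simp
  qed
  then obtain \<rho>t where \<rho>t: "\<And>z. \<rho>t z \<noteq> 0" "\<And>z. \<rho>t (z + (1, 0)) = r1 z * \<rho>t z"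
    "\<And>z. \<rho>t (z + (0, 1)) = r2 z * \<rho>t z"
    using grid_potential[of r1 r2] r1(1) r2(1) by blast
  have "horizontal z (\<rho>t z) (\<rho>t (z + (1, 0)))" "vertical z (\<rho>t z) (\<rho>t (z + (0, 1)))" for z
    using horizontal_scale[OF r1(2), of z "\<rho>t z"] vertical_scale[OF r2(2), of z "\<rho>t z"]
    by (simp_all add: \<rho>t mult.commute)
  then show ?thesis
    using that[of \<rho>t] \<rho>t(1) a_surface_xt corresponding_weingarten_cubes_iff[of \<rho>t]
    by (simp add: crisscrossed_iff)
qed

text \<open>The right-hand side uses only data of the edge, which adjacent quadrilaterals share;
  this is the C1-condition for \<open>xt\<close>.\<close>

lemma edge_plane_eq:
  assumes "\<And>z. \<rho>t z \<noteq> 0" "corresponding_weingarten_cubes x \<rho> xt \<rho>t"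
  shows "edge_span (hquad xt z) (weights \<rho>t z) i =
    span {hquad xt z i, hquad xt z (i + 1), cross_pt (hquad x z) (weights \<rho> z) i}"
proof (rule skew_cube.edge_span_eq[OF skew_cube])
  interpret generic_skew_cube "hquad x z" "hquad xt z"
    by (rule generic_skew_cube)
  show "cross_pt (hquad x z) (weights \<rho> z) i \<in> edge_span (hquad xt z) (weights \<rho>t z) i"
    using assms(2) weingarten_cube_iff[OF cube, of "weights \<rho> z" "weights \<rho>t z" z] assms(1) \<rho>_nonzero
    unfolding corresponding_weingarten_cubes_def net_cross_eq
    by (intro edge_incidence_swap) auto
qed (use assms \<rho>_nonzero in auto)

lemma pre_hyperbolic_transform:
  assumes "crisscrossed xt \<rho>t" "corresponding_weingarten_cubes x \<rho> xt \<rho>t"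
  shows "pre_hyperbolic xt \<rho>t"
proof -
  have nz: "\<And>z. \<rho>t z \<noteq> 0"
    using assms(1) by (simp add: crisscrossed_iff)
  show ?thesis
    using a_surface_xt nz edge_plane_eq[OF nz assms(2)]
    by (simp add: pre_hyperbolic_iff cross_pt_def quad_def corner_simps grid_add insert_commute
        add.commute[of "_ *\<^sub>R pt _" "_ *\<^sub>R pt _"])
qed

lemma weingarten_pair_iff:
  "weingarten_pair x \<rho> xt \<rho>t \<longleftrightarrow> crisscrossed xt \<rho>t \<and> corresponding_weingarten_cubes x \<rho> xt \<rho>t"
  using pre_hyperbolic discrete_weingarten pre_hyperbolic_transform
  by (auto simp: weingarten_pair_def pre_hyperbolic_def)

text \<open>Each edge fixes the ratio of the weights at its ends, so the quotient of two solutions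
  is invariant under both lattice shifts. Conversely, the edge conditions are homogeneous.\<close>

lemma weingarten_pair_unique:
  assumes "weingarten_pair x \<rho> xt \<rho>t"
  shows "weingarten_pair x \<rho> xt \<rho>t' \<longleftrightarrow> (\<exists>c. c \<noteq> 0 \<and> \<rho>t' = (\<lambda>z. c * \<rho>t z))"
proof
  have nz: "\<And>z. \<rho>t z \<noteq> 0" and
    hv: "horizontal z (\<rho>t z) (\<rho>t (z + (1, 0)))" "vertical z (\<rho>t z) (\<rho>t (z + (0, 1)))" for z
    using assms corresponding_weingarten_cubes_iff[of \<rho>t]
    by (auto simp: weingarten_pair_iff crisscrossed_iff)
  {
    assume "weingarten_pair x \<rho> xt \<rho>t'"
    then have nz': "\<And>z. \<rho>t' z \<noteq> 0" and
      hv': "horizontal z (\<rho>t' z) (\<rho>t' (z + (1, 0)))" "vertical z (\<rho>t' z) (\<rho>t' (z + (0, 1)))" for z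
      using corresponding_weingarten_cubes_iff[of \<rho>t']
      by (auto simp: weingarten_pair_iff crisscrossed_iff)
    have "\<rho>t' (z + (1, 0)) / \<rho>t (z + (1, 0)) = \<rho>t' z / \<rho>t z"
      "\<rho>t' (z + (0, 1)) / \<rho>t (z + (0, 1)) = \<rho>t' z / \<rho>t z" for z
      using horizontal_unique[OF hv(1) hv'(1), of z] vertical_unique[OF hv(2) hv'(2), of z]
      by (simp_all add: nz field_simps)
    then have "\<rho>t' z / \<rho>t z = \<rho>t' (0, 0) / \<rho>t (0, 0)" for z
      by (rule grid_shift_invariant_constant[of "\<lambda>z. \<rho>t' z / \<rho>t z"])
    then have "\<rho>t' z = \<rho>t' (0, 0) / \<rho>t (0, 0) * \<rho>t z" for z
      using nz by (metis nonzero_eq_divide_eq)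
    moreover have "\<rho>t' (0, 0) / \<rho>t (0, 0) \<noteq> 0"
      by (simp add: nz nz')
    ultimately show "\<exists>c. c \<noteq> 0 \<and> \<rho>t' = (\<lambda>z. c * \<rho>t z)"
      by blast
  next
    assume "\<exists>c. c \<noteq> 0 \<and> \<rho>t' = (\<lambda>z. c * \<rho>t z)"
    then show "weingarten_pair x \<rho> xt \<rho>t'"
      using corresponding_weingarten_cubes_iff[of \<rho>t'] hv nz horizontal_scale vertical_scale a_surface_xt
      by (auto simp: weingarten_pair_iff crisscrossed_iff)
  }
qed

end

theorem theorem40:
  fixes x xt :: "int \<times> int \<Rightarrow> real^3" and \<rho> :: "int \<times> int \<Rightarrow> real"
  assumes "pre_hyperbolic x \<rho>"
    and "discrete_weingarten x xt"
    and "generic_cubes x xt"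
  shows "(\<exists>\<rho>t. crisscrossed xt \<rho>t \<and> corresponding_weingarten_cubes x \<rho> xt \<rho>t) \<and>
    (\<forall>\<rho>t. crisscrossed xt \<rho>t \<and> corresponding_weingarten_cubes x \<rho> xt \<rho>t \<longrightarrow>
       pre_hyperbolic xt \<rho>t \<and> weingarten_pair x \<rho> xt \<rho>t) \<and>
    (\<forall>\<rho>t \<rho>t'. weingarten_pair x \<rho> xt \<rho>t \<longrightarrow>
       (weingarten_pair x \<rho> xt \<rho>t' \<longleftrightarrow> (\<exists>c. c \<noteq> 0 \<and> \<rho>t' = (\<lambda>z. c * \<rho>t z))))"
proof -
  interpret transformed_net x xt \<rho>
    using assms by (rule transformed_net.intro)
  show ?thesis
    using weights_exist pre_hyperbolic_transform weingarten_pair_iff weingarten_pair_unique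
    by metis
qed

end
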